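(* Let $n\ge 1$. A function $f:[0,1]^n\to[0,1]$ can be implemented by a Bernoulli factory if and only if $f$ is continuous and both $f$ and $1-f$ are polynomially bounded.
   Context: A (multiparameter) Bernoulli factory with input $(p_1,\dots,p_n)$ is a (possibly infinite) rooted binary tree in which every node has either $2$ children (internal node) or $0$ children (leaf). Each internal node is labelled either by an index $i\in[n]=\{1,\dots,n\}$ or by a constant $c\in(0,1)$; each leaf is labelled $0$ or $1$. To execute it with coins $p=(p_1,\dots,p_n)\in[0,1]^n$, start at the root; at an internal node labelled $i$ draw a fresh independent Bernoulli($p_i$) sample (flip the $p_i$-coin), at a node labelled $c$ draw a fresh independent Bernoulli($c$) sample; move to the child corresponding to the outcome $0$ or $1$; upon reaching a leaf output its label. A function $f:D\to[0,1]$, $D\subseteq[0,1]^n$, is implementable by a Bernoulli factory if there is such a tree which, for every $p\in D$, reaches a leaf almost surely and outputs $1$ with probability exactly $f(p)$. Open faces: for a partition $[n]=A\sqcup S\sqcup B$, $F_{A,S,B}=\{p\in[0,1]^n: p_i=0\ (i\in A),\ 0<p_i<1\ (i\in S),\ p_i=1\ (i\in B)\}$. For $T\subseteq[n]$, $p^T=\prod_{i\in T}p_i$ and $(1-p)^T=\prod_{i\in T}(1-p_i)$ (empty products are $1$). For a set $X$, $f|_X\equiv 0$ means $f(p)=0$ for all $p\in X$. A function $f:[0,1]^n\to[0,1]$ is polynomially bounded if there exist an integer $m\ge 0$ and a real $c>0$ such that for every open face $F_{A,S,B}$: if $f|_{F_{A,S,B}}\not\equiv 0$, then $f(p)\ge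 c\left((1-p)^A\, p^S(1-p)^S\, p^B\right)^m$ for all $p\in[0,1]^n$. *)

theory Defs
  imports "HOL-Analysis.Analysis"
begin

text \<open>Node labels of a Bernoulli factory over coins indexed by the finite type 'n:
  Coin i (flip the p_i coin), Cst c (flip a c-coin), Out b (leaf with output b).\<close>
datatype 'n lbl = Coin 'n | Cst real | Out bool

text \<open>A (possibly infinite) binary tree is given by labelling every node, nodes being
  addressed by their path from the root (False = outcome 0, True = outcome 1).
  Nodes below a leaf are not part of the tree (they are reached with probability 0).\<close>
type_synonym 'n bf_tree = "bool list \<Rightarrow> 'n lbl"

definition unit_cube :: "(real^'n) set" where
  "unit_cube = {p. \<forall>i. 0 \<le> p$i \<and> p$i \<le> 1}"

definition valid_bf :: "'n bf_tree \<Rightarrow> bool" where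
  "valid_bf t \<longleftrightarrow> (\<forall>w c. t w = Cst c \<longrightarrow> 0 < c \<and> c < 1)"

fun path_prob :: "'n bf_tree \<Rightarrow> real^'n \<Rightarrow> bool list \<Rightarrow> bool list \<Rightarrow> real" where
  "path_prob t p u [] = 1"
| "path_prob t p u (b # w) =
     (case t u of
        Coin i \<Rightarrow> (if b then p$i else 1 - p$i) * path_prob t p (u @ [b]) w
      | Cst c \<Rightarrow> (if b then c else 1 - c) * path_prob t p (u @ [b]) w
      | Out _ \<Rightarrow> 0)"

definition reach_prob :: "'n bf_tree \<Rightarrow> real^'n \<Rightarrow> bool list \<Rightarrow> real" where
  "reach_prob t p w = path_prob t p [] w"

definition implements_on :: "'n bf_tree \<Rightarrow> (real^'n \<Rightarrow> real) \<Rightarrow> (real^'n) set \<Rightarrow> bool" where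
  "implements_on t f D \<longleftrightarrow>
     (\<forall>p\<in>D. (reach_prob t p has_sum 1) {w. \<exists>b. t w = Out b}
           \<and> (reach_prob t p has_sum f p) {w. t w = Out True})"

definition bernoulli_implementable :: "(real^'n \<Rightarrow> real) \<Rightarrow> bool" where
  "bernoulli_implementable f \<longleftrightarrow> (\<exists>t. valid_bf t \<and> implements_on t f unit_cube)"

definition open_face :: "'n set \<Rightarrow> 'n set \<Rightarrow> 'n set \<Rightarrow> (real^'n) set" where
  "open_face A S B = {p. (\<forall>i\<in>A. p$i = 0) \<and> (\<forall>i\<in>S. 0 < p$i \<and> p$i < 1) \<and> (\<forall>i\<in>B. p$i = 1)}"

definition poly_bounded :: "(real^'n::finite \<Rightarrow> real) \<Rightarrow> bool" where
  "poly_bounded f \<longleftrightarrow>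
     (\<exists>m::nat. \<exists>c::real. c > 0 \<and>
        (\<forall>A S B. A \<inter> S = {} \<and> A \<inter> B = {} \<and> S \<inter> B = {} \<and> A \<union> S \<union> B = UNIV \<longrightarrow>
           (\<exists>p\<in>open_face A S B. f p \<noteq> 0) \<longrightarrow>
           (\<forall>p\<in>unit_cube. f p \<ge> c * ((\<Prod>i\<in>A. 1 - p$i) * (\<Prod>i\<in>S. p$i * (1 - p$i))
                                          * (\<Prod>i\<in>B. p$i)) ^ m)))"

end

theory Submission
  imports Defs
begin

text \<open>
  Necessity. The probability of output 1 within \<open>N\<close> flips is a continuous function of \<open>p\<close> that
  increases to \<open>f p\<close>, so \<open>f\<close> is lower semicontinuous; the same holds for \<open>1 - f\<close>. If \<open>f\<close> is positive
  somewhere on an open face, then so is the probability of some path to a leaf with output 1, and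
  each factor of that probability is bounded below by a multiple of the weight of the face.

  Sufficiency. It is enough to find an implementable \<open>g\<close> with \<open>g \<le> 4 f\<close> and \<open>1 - g \<le> 4 (1 - f)\<close>: then
  \<open>f = g / 8 + 7 / 8 * f'\<close>, where \<open>f'\<close> satisfies the same assumptions as \<open>f\<close>, and the decomposition
  can be iterated. Polynomial boundedness yields implementable \<open>u \<le> f\<close> and \<open>v \<le> 1 - f\<close> with the same
  zeros as \<open>f\<close> and \<open>1 - f\<close>. Flipping the \<open>u\<close>-coin and the \<open>v\<close>-coin alternately until one of them
  succeeds gives an implementable \<open>w\<close> with \<open>\<sigma> w \<le> f\<close> and \<open>\<sigma> (1 - w) \<le> 1 - f\<close> for some \<open>\<sigma> > 0\<close>. Now
  flip the \<open>w\<close>-coin \<open>m\<close> times; if the outcomes agree, output the common value, otherwise flip a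
  \<open>b\<close>-coin, where \<open>b\<close> is implementable and uniformly close to \<open>f\<close>. For large \<open>m\<close> the powers \<open>w ^ m\<close>
  and \<open>(1 - w) ^ m\<close> are at most \<open>2 f\<close> and \<open>2 (1 - f)\<close>, and disagreement has probability at most
  \<open>m * w\<close> and \<open>m * (1 - w)\<close>, which makes the \<open>b\<close>-coin harmless where \<open>f\<close> is close to 0 or 1.
\<close>

section \<open>Output probabilities of a machine\<close>

text \<open>The value 0 at a leaf makes the recursions below stop there without a case
  distinction.\<close>

definition flip_prob :: "'n lbl \<Rightarrow> real^'n \<Rightarrow> bool \<Rightarrow> real" where
  "flip_prob l p x = (case l of
     Coin i \<Rightarrow> if x then p$i else 1 - p$i
   | Cst c \<Rightarrow> if x then c else 1 - c
   | Out _ \<Rightarrow> 0)"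

text \<open>The probability of output \<open>b\<close> within \<open>N\<close> flips. An arbitrary
  state type lets composite experiments carry their own bookkeeping; trees are the case where
  \<open>nx\<close> appends the outcome to the path.\<close>

primrec out_prob ::
  "('s \<Rightarrow> 'n lbl) \<Rightarrow> ('s \<Rightarrow> bool \<Rightarrow> 's) \<Rightarrow> real^'n \<Rightarrow> bool \<Rightarrow> nat \<Rightarrow> 's \<Rightarrow> real" where
  "out_prob lab nx p b 0 s = of_bool (lab s = Out b)"
| "out_prob lab nx p b (Suc N) s = of_bool (lab s = Out b)
     + flip_prob (lab s) p True * out_prob lab nx p b N (nx s True)
     + flip_prob (lab s) p False * out_prob lab nx p b N (nx s False)"

lemma flip_prob_Out [simp]: "flip_prob (Out b) p x = 0"
  by (simp add: flip_prob_def)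

lemma flip_prob_Cst [simp]: "flip_prob (Cst c) p x = (if x then c else 1 - c)"
  by (simp add: flip_prob_def)

lemma flip_prob_Coin [simp]: "flip_prob (Coin i) p x = (if x then p$i else 1 - p$i)"
  by (simp add: flip_prob_def)

lemma out_prob_Out: "lab s = Out c \<Longrightarrow> out_prob lab nx p b N s = of_bool (c = b)"
  by (cases N) auto

locale bf_machine =
  fixes lab :: "'s \<Rightarrow> 'n::finite lbl" and nx :: "'s \<Rightarrow> bool \<Rightarrow> 's" and p :: "real^'n"
  assumes Cst: "lab s = Cst c \<Longrightarrow> 0 < c \<and> c < 1"
    and cube: "p \<in> unit_cube"
begin

lemma flip_prob_nonneg: "0 \<le> flip_prob (lab s) p x"
  using Cst[of s] cube by (cases "lab s") (auto simp: flip_prob_def unit_cube_def less_imp_le)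

lemma flip_prob_total:
  "flip_prob (lab s) p True + flip_prob (lab s) p False = of_bool (\<forall>b. lab s \<noteq> Out b)"
  by (cases "lab s") (auto simp: flip_prob_def)

lemma out_prob_nonneg: "0 \<le> out_prob lab nx p b N s"
  by (induction N arbitrary: s) (auto simp: flip_prob_nonneg)

lemma out_prob_Suc: "out_prob lab nx p b N s \<le> out_prob lab nx p b (Suc N) s"
proof (induction N arbitrary: s)
  case 0
  then show ?case by (simp add: flip_prob_nonneg)
next
  case (Suc N)
  show ?case
    unfolding out_prob.simps(2)[of lab nx p b N s] out_prob.simps(2)[of lab nx p b "Suc N" s]
    by (intro add_mono mult_left_mono Suc flip_prob_nonneg order_refl)
qed

lemma incseq_out_prob: "incseq (\<lambda>N. out_prob lab nx p b N s)"
  by (intro incseq_SucI out_prob_Suc)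

lemma out_prob_total_le: "out_prob lab nx p True N s + out_prob lab nx p False N s \<le> 1"
proof (induction N arbitrary: s)
  case (Suc N)
  show ?case
  proof (cases "\<exists>b. lab s = Out b")
    case False
    have "out_prob lab nx p True (Suc N) s + out_prob lab nx p False (Suc N) s =
      flip_prob (lab s) p True
        * (out_prob lab nx p True N (nx s True) + out_prob lab nx p False N (nx s True))
      + flip_prob (lab s) p False
        * (out_prob lab nx p True N (nx s False) + out_prob lab nx p False N (nx s False))"
      using False by (simp add: algebra_simps)
    also have "\<dots> \<le> flip_prob (lab s) p True * 1 + flip_prob (lab s) p False * 1"
      by (intro add_mono mult_left_mono Suc flip_prob_nonneg)
    finally show ?thesis using flip_prob_total[of s] False by simp
  qed auto
qed auto

lemma out_prob_le_1: "out_prob lab nx p b N s \<le> 1"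
  using out_prob_total_le[of N s] out_prob_nonneg[of True N s] out_prob_nonneg[of False N s]
  by (cases b) auto

definition out_lim :: "bool \<Rightarrow> 's \<Rightarrow> real" where
  "out_lim b s = lim (\<lambda>N. out_prob lab nx p b N s)"

lemma out_lim: "(\<lambda>N. out_prob lab nx p b N s) \<longlonglongrightarrow> out_lim b s"
  unfolding out_lim_def
  by (intro convergent_LIMSEQ_iff[THEN iffD1] Bseq_mono_convergent BseqI'[of _ 1])
     (use incseq_out_prob out_prob_nonneg out_prob_le_1 in \<open>auto simp: incseq_def\<close>)

lemma out_prob_le_lim: "out_prob lab nx p b N s \<le> out_lim b s"
  by (rule incseq_le[OF incseq_out_prob out_lim])

lemma out_lim_nonneg: "0 \<le> out_lim b s"
  using out_prob_nonneg out_prob_le_lim order_trans by blast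

lemma out_lim_total_le: "out_lim True s + out_lim False s \<le> 1"
  by (rule LIMSEQ_le_const2[OF tendsto_add[OF out_lim out_lim]]) (use out_prob_total_le in blast)

lemma out_lim_unfold:
  "out_lim b s = of_bool (lab s = Out b) + flip_prob (lab s) p True * out_lim b (nx s True)
     + flip_prob (lab s) p False * out_lim b (nx s False)"
proof (rule LIMSEQ_unique)
  show "(\<lambda>N. out_prob lab nx p b (Suc N) s) \<longlonglongrightarrow> out_lim b s"
    using out_lim LIMSEQ_Suc by blast
  show "(\<lambda>N. out_prob lab nx p b (Suc N) s) \<longlonglongrightarrow>
    of_bool (lab s = Out b) + flip_prob (lab s) p True * out_lim b (nx s True)
     + flip_prob (lab s) p False * out_lim b (nx s False)"
    unfolding out_prob.simps by (intro tendsto_intros out_lim)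
qed

end

section \<open>Trees as machines\<close>

abbreviation snoc :: "bool list \<Rightarrow> bool \<Rightarrow> bool list" where
  "snoc w x \<equiv> w @ [x]"

abbreviation tree_out :: "'n bf_tree \<Rightarrow> real^'n \<Rightarrow> bool \<Rightarrow> nat \<Rightarrow> real" where
  "tree_out t p b N \<equiv> out_prob t snoc p b N []"

text \<open>Labelling each history with the label of the state it leads to turns a machine into a
  tree with the same output probabilities, so it suffices to construct machines.\<close>

lemma out_prob_unfold_tree:
  "out_prob (\<lambda>w. lab (foldl nx s w)) snoc p b N w = out_prob lab nx p b N (foldl nx s w)"
  by (induction N arbitrary: w) auto

lemma finite_bool_lists: "finite {w :: bool list. length w \<le> N}"
  using finite_lists_length_le[of "UNIV :: bool set" N] by simp

text \<open>Split the paths according to the first flip.\<close>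

lemma sum_path_prob:
  "(\<Sum>w | length w \<le> N \<and> t (u @ w) = Out b. path_prob t p u w) = out_prob t snoc p b N u"
proof (induction N arbitrary: u)
  case 0
  have "{w. length w \<le> 0 \<and> t (u @ w) = Out b} = (if t u = Out b then {[]} else {})"
    by auto
  then show ?case by simp
next
  case (Suc N)
  let ?A = "\<lambda>x. {w. length w \<le> N \<and> t (snoc u x @ w) = Out b}"
  have fin: "finite (?A x)" for x
    by (rule finite_subset[OF _ finite_bool_lists[of N]]) auto
  have eq: "{w. length w \<le> Suc N \<and> t (u @ w) = Out b} =
    (if t u = Out b then {[]} else {}) \<union> ((#) True ` ?A True \<union> (#) False ` ?A False)"
    (is "?L = ?R")
  proof (intro equalityI subsetI)
    fix w assume w: "w \<in> ?L"
    show "w \<in> ?R"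
    proof (cases w)
      case (Cons x v)
      then show ?thesis using w by (cases x) auto
    qed (use w in auto)
  qed (auto split: if_splits)
  \<comment> \<open>If \<open>u\<close> is a leaf, both sides are 0: paths continuing below a leaf
    are in the index set but carry no mass.\<close>
  have step: "(\<Sum>w\<in>(#) x ` ?A x. path_prob t p u w)
      = flip_prob (t u) p x * out_prob t snoc p b N (snoc u x)" for x
  proof -
    have "(\<Sum>w\<in>(#) x ` ?A x. path_prob t p u w) = (\<Sum>w\<in>?A x. path_prob t p u (x # w))"
      by (subst sum.reindex) (auto simp: inj_on_def)
    also have "\<dots> = (\<Sum>w\<in>?A x. flip_prob (t u) p x * path_prob t p (snoc u x) w)"
      by (intro sum.cong) (auto simp: flip_prob_def split: lbl.splits)
    finally show ?thesis unfolding Suc[of "snoc u x", symmetric] by (simp only: sum_distrib_left)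
  qed
  have "(\<Sum>w | length w \<le> Suc N \<and> t (u @ w) = Out b. path_prob t p u w) =
    of_bool (t u = Out b) + ((\<Sum>w\<in>(#) True ` ?A True. path_prob t p u w)
      + (\<Sum>w\<in>(#) False ` ?A False. path_prob t p u w))"
    unfolding eq
    by (subst sum.union_disjoint, use fin in simp, use fin in simp, force)
       (subst sum.union_disjoint, use fin in simp, use fin in simp, force, simp)
  then show ?case unfolding step by simp
qed

text \<open>The paths in \<open>A\<close> of length at most \<open>N\<close> form finite sets
  exhausting \<open>A\<close>, which gives one direction. Conversely, by nonnegativity a limit of
  these sums bounds all finite sums, so \<open>g\<close> is summable.\<close>

lemma has_sum_iff_tendsto_length:
  fixes g :: "bool list \<Rightarrow> real"
  assumes nonneg: "\<And>w. 0 \<le> g w"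
  shows "(g has_sum x) A \<longleftrightarrow> (\<lambda>N. \<Sum>w | length w \<le> N \<and> w \<in> A. g w) \<longlonglongrightarrow> x"
proof -
  let ?A = "\<lambda>N. {w. length w \<le> N \<and> w \<in> A}"
  have fin: "finite (?A N)" for N
    by (rule finite_subset[OF _ finite_bool_lists[of N]]) auto
  have exhaust: "\<exists>N. F \<subseteq> ?A N" if "finite F" "F \<subseteq> A" for F
    using that by (intro exI[of _ "Max (length ` F)"]) auto
  have lim: "filterlim ?A (finite_subsets_at_top A) sequentially"
    unfolding filterlim_finite_subsets_at_top
  proof (intro allI impI)
    fix F assume F: "finite F \<and> F \<subseteq> A"
    then obtain N where "F \<subseteq> ?A N" using exhaust by blast
    then show "\<forall>\<^sub>F n in sequentially. finite (?A n) \<and> F \<subseteq> ?A n \<and> ?A n \<subseteq> A"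
      unfolding eventually_sequentially using fin by (intro exI[of _ N]) fastforce
  qed
  have fwd: "(\<lambda>N. sum g (?A N)) \<longlonglongrightarrow> y" if "(g has_sum y) A" for y
    using filterlim_compose[OF that[unfolded has_sum_def] lim] .
  show ?thesis
  proof
    assume lim_x: "(\<lambda>N. sum g (?A N)) \<longlonglongrightarrow> x"
    have "incseq (\<lambda>N. sum g (?A N))"
      by (intro incseq_SucI sum_mono2 fin) (auto simp: nonneg)
    then have le: "sum g (?A N) \<le> x" for N using incseq_le lim_x by blast
    have "g summable_on A"
    proof (rule nonneg_bdd_above_summable_on)
      show "bdd_above (sum g ` {F. F \<subseteq> A \<and> finite F})"
      proof (rule bdd_aboveI2)
        fix F assume "F \<in> {F. F \<subseteq> A \<and> finite F}"
        then obtain N where "F \<subseteq> ?A N" using exhaust by blast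
        then have "sum g F \<le> sum g (?A N)" by (intro sum_mono2 fin) (auto simp: nonneg)
        then show "sum g F \<le> x" using le order_trans by blast
      qed
    qed (use nonneg in auto)
    then obtain y where "(g has_sum y) A" by (auto simp: summable_on_def)
    then show "(g has_sum x) A" using fwd LIMSEQ_unique lim_x by blast
  qed (rule fwd)
qed

lemma path_prob_nonneg:
  assumes "valid_bf t" "p \<in> unit_cube"
  shows "0 \<le> path_prob t p u w"
  using assms
  by (induction w arbitrary: u)
     (auto simp: valid_bf_def unit_cube_def less_imp_le split: lbl.splits intro!: mult_nonneg_nonneg)

lemma machine_tree: "valid_bf t \<Longrightarrow> p \<in> unit_cube \<Longrightarrow> bf_machine t p"
  by unfold_locales (auto simp: valid_bf_def)

text \<open>Halting almost surely means that the two limiting output probabilities add up to 1; this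
  form treats both outputs symmetrically.\<close>

lemma implements_on_iff:
  assumes t: "valid_bf t"
  shows "implements_on t f unit_cube \<longleftrightarrow> (\<forall>p\<in>unit_cube.
    tree_out t p True \<longlonglongrightarrow> f p \<and> tree_out t p False \<longlonglongrightarrow> 1 - f p)"
proof -
  have "(reach_prob t p has_sum 1) {w. \<exists>b. t w = Out b} \<and> (reach_prob t p has_sum f p) {w. t w = Out True}
      \<longleftrightarrow> tree_out t p True \<longlonglongrightarrow> f p \<and> tree_out t p False \<longlonglongrightarrow> 1 - f p"
    if p: "p \<in> unit_cube" for p
  proof -
    have nn: "0 \<le> reach_prob t p w" for w
      using path_prob_nonneg[OF t p] by (simp add: reach_prob_def)
    have out: "(\<Sum>w | length w \<le> N \<and> w \<in> {w. t w = Out b}. reach_prob t p w) = tree_out t p b N" for b N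
      using sum_path_prob[where u = "[]" and N = N and t = t and b = b and p = p] by (simp add: reach_prob_def)
    have all: "(\<Sum>w | length w \<le> N \<and> w \<in> {w. \<exists>b. t w = Out b}. reach_prob t p w)
       = tree_out t p True N + tree_out t p False N" for N
    proof -
      have "{w. length w \<le> N \<and> w \<in> {w. \<exists>b. t w = Out b}} =
        {w. length w \<le> N \<and> w \<in> {w. t w = Out True}} \<union> {w. length w \<le> N \<and> w \<in> {w. t w = Out False}}"
        by auto
      moreover have "finite {w. length w \<le> N \<and> w \<in> {w. t w = Out b}}" for b
        by (rule finite_subset[OF _ finite_bool_lists[of N]]) auto
      ultimately show ?thesis
        unfolding out[symmetric] by (simp only:) (rule sum.union_disjoint, auto)
    qed
    show ?thesis
      unfolding has_sum_iff_tendsto_length[OF nn] out all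
    proof safe
      assume "(\<lambda>N. tree_out t p True N + tree_out t p False N) \<longlonglongrightarrow> 1" "tree_out t p True \<longlonglongrightarrow> f p"
      from tendsto_diff[OF this] show "tree_out t p False \<longlonglongrightarrow> 1 - f p" by simp
    next
      assume "tree_out t p True \<longlonglongrightarrow> f p" "tree_out t p False \<longlonglongrightarrow> 1 - f p"
      from tendsto_add[OF this] show "(\<lambda>N. tree_out t p True N + tree_out t p False N) \<longlonglongrightarrow> 1" by simp
    qed
  qed
  then show ?thesis unfolding implements_on_def by blast
qed

section \<open>Closure properties of implementable functions\<close>

lemma bernoulli_implementable_iff:
  "bernoulli_implementable f \<longleftrightarrow> (\<exists>t. valid_bf t \<and> (\<forall>p\<in>unit_cube.
    tree_out t p True \<longlonglongrightarrow> f p \<and> tree_out t p False \<longlonglongrightarrow> 1 - f p))"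
  unfolding bernoulli_implementable_def using implements_on_iff by blast

lemma implementable_bounds:
  assumes "bernoulli_implementable f" "p \<in> unit_cube"
  shows "0 \<le> f p" "f p \<le> 1"
proof -
  obtain t where t: "valid_bf t" "tree_out t p True \<longlonglongrightarrow> f p"
    using assms unfolding bernoulli_implementable_iff by blast
  interpret bf_machine t snoc p by (rule machine_tree[OF t(1) assms(2)])
  show "0 \<le> f p" using LIMSEQ_le_const[OF t(2)] out_prob_nonneg by blast
  show "f p \<le> 1" using LIMSEQ_le_const2[OF t(2)] out_prob_le_1 by blast
qed

text \<open>Lower bounds for both outputs suffice, since the two output probabilities add up to at most 1.\<close>

lemma implementable_machineI:
  fixes lab :: "'s \<Rightarrow> 'n::finite lbl"
  assumes cst: "\<And>s c. lab s = Cst c \<Longrightarrow> 0 < c \<and> c < 1"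
    and ge: "\<And>p. p \<in> unit_cube \<Longrightarrow> f p \<le> bf_machine.out_lim lab nx p True s"
            "\<And>p. p \<in> unit_cube \<Longrightarrow> 1 - f p \<le> bf_machine.out_lim lab nx p False s"
  shows "bernoulli_implementable f"
  unfolding bernoulli_implementable_iff
proof (intro exI[of _ "\<lambda>w. lab (foldl nx s w)"] conjI ballI)
  fix p :: "real^'n" assume p: "p \<in> unit_cube"
  interpret bf_machine lab nx p using cst p by unfold_locales auto
  have "out_lim True s = f p" "out_lim False s = 1 - f p"
    using ge[OF p] out_lim_total_le[of s] by linarith+
  then show "tree_out (\<lambda>w. lab (foldl nx s w)) p True \<longlonglongrightarrow> f p"
    "tree_out (\<lambda>w. lab (foldl nx s w)) p False \<longlonglongrightarrow> 1 - f p"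
    unfolding out_prob_unfold_tree using out_lim[of True s] out_lim[of False s] by auto
qed (use cst in \<open>auto simp: valid_bf_def\<close>)

section \<open>Elementary experiments\<close>

lemma implementable_one_step:
  fixes l :: "'n::finite lbl"
  assumes "\<And>c. l = Cst c \<Longrightarrow> 0 < c \<and> c < 1" "\<And>b. l \<noteq> Out b"
  shows "bernoulli_implementable (\<lambda>p. flip_prob l p True)"
proof (rule implementable_machineI)
  \<comment> \<open>\<open>None\<close> is the flip, \<open>Some b\<close> the leaf reached by
    outcome \<open>b\<close>.\<close>
  let ?lab = "\<lambda>s. case s of None \<Rightarrow> l | Some b \<Rightarrow> Out b"
  show "0 < c \<and> c < 1" if "?lab s = Cst c" for s c
    using that assms by (auto split: option.splits)
  fix p :: "real^'n" assume p: "p \<in> unit_cube"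
  interpret bf_machine ?lab "\<lambda>_. Some" p
    using assms p by unfold_locales (auto split: option.splits)
  have "out_lim b (Some c) = of_bool (c = b)" for b c
    by (subst out_lim_unfold) simp
  then have *: "out_lim b None = flip_prob l p b" for b
    by (subst out_lim_unfold) (use assms(2) in auto)
  show "flip_prob l p True \<le> out_lim True None" by (simp add: *)
  have "flip_prob l p True + flip_prob l p False = 1"
    using flip_prob_total[of None] assms(2) by simp
  then show "1 - flip_prob l p True \<le> out_lim False None" by (simp add: *)
qed

lemma implementable_coin: "bernoulli_implementable (\<lambda>p :: real^'n::finite. p$i)"
  using implementable_one_step[of "Coin i"] by simp

lemma implementable_bool: "bernoulli_implementable (\<lambda>p :: real^'n::finite. of_bool b)"
  unfolding bernoulli_implementable_iff
  \<comment> \<open>The root is already a leaf.\<close>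
  by (intro exI[of _ "\<lambda>_. Out b"]) (auto simp: valid_bf_def out_prob_Out)

text \<open>Labels \<open>Cst c\<close> demand \<open>0 < c < 1\<close>, so the two endpoints come
  from single leaves.\<close>

lemma implementable_const:
  assumes "0 \<le> c" "c \<le> 1"
  shows "bernoulli_implementable (\<lambda>p :: real^'n::finite. c)"
proof -
  consider "c = 0" | "c = 1" | "0 < c" "c < 1" using assms by linarith
  then show ?thesis
    using implementable_one_step[of "Cst c"] implementable_bool[of True] implementable_bool[of False]
    by cases auto
qed

text \<open>In state \<open>(k, False, u)\<close> the machine runs the tree \<open>a k\<close> and is at node \<open>u\<close>; in state
  \<open>(k, True, u)\<close> it runs \<open>b k\<close>. A machine has to flip a coin in every step, so the change of
  trees at a leaf of \<open>a k\<close> is masked by a fair coin whose outcome is ignored.\<close>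

fun seq_lab :: "(nat \<Rightarrow> 'n bf_tree) \<Rightarrow> (nat \<Rightarrow> 'n bf_tree) \<Rightarrow> nat \<times> bool \<times> bool list \<Rightarrow> 'n lbl" where
  "seq_lab a b (k, True, u) = b k u"
| "seq_lab a b (k, False, u) = (case a k u of Out _ \<Rightarrow> Cst (1/2) | l \<Rightarrow> l)"

fun seq_next :: "(nat \<Rightarrow> 'n bf_tree) \<Rightarrow> nat \<times> bool \<times> bool list \<Rightarrow> bool \<Rightarrow> nat \<times> bool \<times> bool list" where
  "seq_next a (k, True, u) x = (k, True, snoc u x)"
| "seq_next a (k, False, u) x =
     (case a k u of Out c \<Rightarrow> (if c then (k, True, []) else (Suc k, False, [])) | _ \<Rightarrow> (k, False, snoc u x))"

lemma seq_lab_Cst: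
  assumes "\<And>k. valid_bf (a k)" "\<And>k. valid_bf (b k)" "seq_lab a b s = Cst c"
  shows "0 < c \<and> c < 1"
  using assms(3) assms(1,2)[unfolded valid_bf_def]
  by (cases "(a, b, s)" rule: seq_lab.cases) (fastforce split: lbl.splits)+

text \<open>An inequality suffices for \<open>implementable_machineI\<close>. It holds with the run
  of \<open>a k\<close> cut off after \<open>N\<close> flips, by induction on \<open>N\<close>; then
  \<open>N\<close> tends to infinity.\<close>

lemma seq_out_lim_ge:
  fixes a b :: "nat \<Rightarrow> 'n::finite bf_tree"
  assumes valid: "\<And>k. valid_bf (a k)" "\<And>k. valid_bf (b k)" and p: "p \<in> unit_cube"
    and a: "\<And>k. tree_out (a k) p True \<longlonglongrightarrow> \<alpha> k" "\<And>k. tree_out (a k) p False \<longlonglongrightarrow> 1 - \<alpha> k"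
    and b: "\<And>k. tree_out (b k) p x \<longlonglongrightarrow> \<beta> k"
  shows "bf_machine.out_lim (seq_lab a b) (seq_next a) p x (k, False, [])
    \<ge> \<alpha> k * \<beta> k + (1 - \<alpha> k) * bf_machine.out_lim (seq_lab a b) (seq_next a) p x (Suc k, False, [])"
proof -
  interpret bf_machine "seq_lab a b" "seq_next a" p
    using seq_lab_Cst[OF valid] p by unfold_locales
  interpret A: bf_machine "a k" snoc p by (rule machine_tree[OF valid(1) p])
  have "out_prob (seq_lab a b) (seq_next a) p x N (k, True, u) = out_prob (b k) snoc p x N u" for N u
    by (induction N arbitrary: u) auto
  from b[of k, folded this] have lim_b: "out_lim x (k, True, []) = \<beta> k"
    using out_lim LIMSEQ_unique by blast
  define S where "S = out_lim x (Suc k, False, [])"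
  have \<beta>: "\<beta> k \<ge> 0" and S: "S \<ge> 0"
    unfolding lim_b[symmetric] S_def by (rule out_lim_nonneg)+
  \<comment> \<open>Both outcomes of the masking coin lead to the same state, so its weights 1/2 and
    1/2 add up to 1.\<close>
  have leaf: "out_lim x (k, False, u) = (if c then \<beta> k else S)" if "a k u = Out c" for u c
    using that by (subst out_lim_unfold) (simp add: lim_b S_def)
  have step: "out_prob (a k) snoc p True N u * \<beta> k + out_prob (a k) snoc p False N u * S
      \<le> out_lim x (k, False, u)" for N u
  proof (induction N arbitrary: u)
    case 0
    show ?case
    proof (cases "\<exists>c. a k u = Out c")
      case False
      then show ?thesis using out_lim_nonneg by auto
    qed (use leaf in auto)
  next
    case (Suc N)
    show ?case
    proof (cases "\<exists>c. a k u = Out c")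
      case False
      then have lab: "seq_lab a b (k, False, u) = a k u" "seq_next a (k, False, u) y = (k, False, snoc u y)" for y
        by (auto split: lbl.splits)
      have "out_prob (a k) snoc p True (Suc N) u * \<beta> k + out_prob (a k) snoc p False (Suc N) u * S
        = flip_prob (a k u) p True * (out_prob (a k) snoc p True N (snoc u True) * \<beta> k
             + out_prob (a k) snoc p False N (snoc u True) * S)
        + flip_prob (a k u) p False * (out_prob (a k) snoc p True N (snoc u False) * \<beta> k
             + out_prob (a k) snoc p False N (snoc u False) * S)"
        using False by (simp add: algebra_simps)
      also have "\<dots> \<le> flip_prob (a k u) p True * out_lim x (k, False, snoc u True)
        + flip_prob (a k u) p False * out_lim x (k, False, snoc u False)"
        by (intro add_mono mult_left_mono Suc A.flip_prob_nonneg)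
      also have "\<dots> = out_lim x (k, False, u)"
        unfolding out_lim_unfold[of x "(k, False, u)"] lab using False by simp
      finally show ?thesis .
    qed (use leaf in auto)
  qed
  have "(\<lambda>N. tree_out (a k) p True N * \<beta> k + tree_out (a k) p False N * S)
      \<longlonglongrightarrow> \<alpha> k * \<beta> k + (1 - \<alpha> k) * S"
    by (intro tendsto_intros a)
  then have "\<alpha> k * \<beta> k + (1 - \<alpha> k) * S \<le> out_lim x (k, False, [])"
    by (rule LIMSEQ_le_const2) (use step[where u = "[]"] in auto)
  then show ?thesis by (simp add: S_def)
qed

text \<open>The experiment: for \<open>k = 0, 1, \<dots>\<close> flip an \<open>a k\<close>-coin, and upon the first success output a
  flip of the corresponding \<open>b k\<close>-coin. The probability of output 1 when starting with the \<open>k\<close>-th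
  round is \<open>r k\<close>.\<close>

lemma implementable_sequential:
  fixes a b r :: "nat \<Rightarrow> real^'n::finite \<Rightarrow> real"
  assumes a: "\<And>k. bernoulli_implementable (a k)" and b: "\<And>k. bernoulli_implementable (b k)"
    and r: "\<And>k p. p \<in> unit_cube \<Longrightarrow> r k p = a k p * b k p + (1 - a k p) * r (Suc k) p"
    and r01: "\<And>k p. p \<in> unit_cube \<Longrightarrow> 0 \<le> r k p \<and> r k p \<le> 1"
    and stop: "\<And>p. p \<in> unit_cube \<Longrightarrow> (\<lambda>K. \<Prod>j<K. 1 - a j p) \<longlonglongrightarrow> 0"
  shows "bernoulli_implementable (r 0)"
proof -
  obtain ta where ta: "\<And>k. valid_bf (ta k)"
    "\<And>k p. p \<in> unit_cube \<Longrightarrow> tree_out (ta k) p True \<longlonglongrightarrow> a k p"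
    "\<And>k p. p \<in> unit_cube \<Longrightarrow> tree_out (ta k) p False \<longlonglongrightarrow> 1 - a k p"
    using a unfolding bernoulli_implementable_iff by metis
  obtain tb where tb: "\<And>k. valid_bf (tb k)"
    "\<And>k p. p \<in> unit_cube \<Longrightarrow> tree_out (tb k) p True \<longlonglongrightarrow> b k p"
    "\<And>k p. p \<in> unit_cube \<Longrightarrow> tree_out (tb k) p False \<longlonglongrightarrow> 1 - b k p"
    using b unfolding bernoulli_implementable_iff by metis
  \<comment> \<open>Stated for a generic output \<open>x\<close>, to be used with \<open>r\<close>
    for output 1 and with \<open>1 - r\<close> for output 0.\<close>
  have ge: "\<rho> 0 \<le> bf_machine.out_lim (seq_lab ta tb) (seq_next ta) p x (0, False, [])"
    if p: "p \<in> unit_cube" and \<beta>: "\<And>k. tree_out (tb k) p x \<longlonglongrightarrow> \<beta> k"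
      and \<rho>: "\<And>k. \<rho> k = a k p * \<beta> k + (1 - a k p) * \<rho> (Suc k)" "\<And>k. \<rho> k \<le> 1"
    for p x and \<beta> \<rho> :: "nat \<Rightarrow> real"
  proof -
    interpret bf_machine "seq_lab ta tb" "seq_next ta" p
      using seq_lab_Cst[OF ta(1) tb(1)] p by unfold_locales
    let ?L = "\<lambda>k. out_lim x (k, False, [])"
    \<comment> \<open>The deficit after \<open>K\<close> rounds is at most the probability that none
      of them succeeded, which vanishes in the limit by \<open>stop\<close>.\<close>
    have "\<rho> k - (\<Prod>j<K. 1 - a (k + j) p) \<le> ?L k" for K k
    proof (induction K arbitrary: k)
      case 0
      show ?case using \<rho>(2)[of k] out_lim_nonneg[of x "(k, False, [])"] by simp
    next
      case (Suc K)
      have "\<rho> k - (\<Prod>j<Suc K. 1 - a (k + j) p)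
        = a k p * \<beta> k + (1 - a k p) * (\<rho> (Suc k) - (\<Prod>j<K. 1 - a (Suc k + j) p))"
        by (subst \<rho>(1)) (simp add: prod.lessThan_Suc_shift algebra_simps del: prod.lessThan_Suc)
      also have "\<dots> \<le> a k p * \<beta> k + (1 - a k p) * ?L (Suc k)"
        using implementable_bounds[OF a[of k] p] by (intro add_left_mono mult_left_mono Suc) auto
      also have "\<dots> \<le> ?L k"
        by (rule seq_out_lim_ge[OF ta(1) tb(1) p ta(2,3)[OF p] \<beta>])
      finally show ?case .
    qed
    from this[of 0] have "\<rho> 0 - (\<Prod>j<K. 1 - a j p) \<le> ?L 0" for K by simp
    moreover have "(\<lambda>K. \<rho> 0 - (\<Prod>j<K. 1 - a j p)) \<longlonglongrightarrow> \<rho> 0 - 0"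
      by (intro tendsto_intros stop[OF p])
    ultimately show ?thesis using LIMSEQ_le_const2 by fastforce
  qed
  show ?thesis
  proof (rule implementable_machineI[OF seq_lab_Cst[OF ta(1) tb(1)]])
    fix p :: "real^'n" assume p: "p \<in> unit_cube"
    show "r 0 p \<le> bf_machine.out_lim (seq_lab ta tb) (seq_next ta) p True (0, False, [])"
      by (rule ge[OF p tb(2)[OF p], of "\<lambda>k. r k p", OF r[OF p]]) (use r01[OF p] in auto)
    show "1 - r 0 p \<le> bf_machine.out_lim (seq_lab ta tb) (seq_next ta) p False (0, False, [])"
    proof (rule ge[OF p tb(3)[OF p], of "\<lambda>k. 1 - r k p"])
      show "1 - r k p = a k p * (1 - b k p) + (1 - a k p) * (1 - r (Suc k) p)" for k
        by (subst r[OF p]) (simp add: algebra_simps)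
    qed (use r01[OF p] in auto)
  qed
qed

section \<open>Mixtures, products and races\<close>

lemma implementable_mix:
  fixes w g h :: "real^'n::finite \<Rightarrow> real"
  assumes "bernoulli_implementable w" "bernoulli_implementable g" "bernoulli_implementable h"
  shows "bernoulli_implementable (\<lambda>p. w p * g p + (1 - w p) * h p)"
proof -
  \<comment> \<open>Round 0 flips the \<open>w\<close>-coin and upon success outputs a
    \<open>g\<close>-flip; round 1 succeeds surely and outputs an \<open>h\<close>-flip.\<close>
  let ?r = "\<lambda>k :: nat. if k = 0 then (\<lambda>p. w p * g p + (1 - w p) * h p) else h"
  have "bernoulli_implementable (?r 0)"
  proof (rule implementable_sequential[where r = ?r and a = "\<lambda>k. if k = 0 then w else (\<lambda>_. 1)"
        and b = "\<lambda>k. if k = 0 then g else h"])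
    show "bernoulli_implementable (if k = 0 then w else (\<lambda>_. 1))"
      "bernoulli_implementable (if k = 0 then g else h)" for k :: nat
      using assms implementable_const[of 1] by auto
    fix p :: "real^'n" assume p: "p \<in> unit_cube"
    note bd = implementable_bounds[OF assms(1) p] implementable_bounds[OF assms(2) p]
       implementable_bounds[OF assms(3) p]
    have "w p * g p + (1 - w p) * h p \<le> w p * 1 + (1 - w p) * 1"
      using bd by (intro add_mono mult_left_mono) auto
    then show "0 \<le> ?r k p \<and> ?r k p \<le> 1" for k
      using bd by auto
    show "?r k p = (if k = 0 then w else (\<lambda>_. 1)) p * (if k = 0 then g else h) p
        + (1 - (if k = 0 then w else (\<lambda>_. 1)) p) * ?r (Suc k) p" for k
      by auto
    \<comment> \<open>The factor for round 1 is 0, so every product of at least two factors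
      vanishes.\<close>
    have zero: "(\<Prod>j<Suc (Suc K). 1 - (if j = 0 then w else (\<lambda>_. 1)) p) = 0" for K
      by (intro prod_zero bexI[of _ 1]) auto
    show "(\<lambda>K. \<Prod>j<K. 1 - (if j = 0 then w else (\<lambda>_. 1)) p) \<longlonglongrightarrow> 0"
      by (rule LIMSEQ_offset[of _ 2]) (simp only: add_2_eq_Suc' zero tendsto_const)
  qed
  then show ?thesis by simp
qed

lemma implementable_compl: "bernoulli_implementable g \<Longrightarrow> bernoulli_implementable (\<lambda>p. 1 - g p)"
  using implementable_mix[of g "\<lambda>_. 0" "\<lambda>_. 1"] implementable_const[of 0] implementable_const[of 1] by simp

lemma implementable_mult:
  "bernoulli_implementable g \<Longrightarrow> bernoulli_implementable h \<Longrightarrow> bernoulli_implementable (\<lambda>p. g p * h p)"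
  using implementable_mix[of g h "\<lambda>_. 0"] implementable_const[of 0] by simp

lemma implementable_prod:
  assumes "finite I" "\<And>i. i \<in> I \<Longrightarrow> bernoulli_implementable (g i)"
  shows "bernoulli_implementable (\<lambda>p. \<Prod>i\<in>I. g i p)"
  using assms by (induction I) (auto intro: implementable_const implementable_mult)

lemma implementable_power: "bernoulli_implementable g \<Longrightarrow> bernoulli_implementable (\<lambda>p. g p ^ m)"
  by (induction m) (auto intro: implementable_const implementable_mult)

text \<open>The \<open>u\<close>-coin, flipped in even rounds, wins with output 1, the
  \<open>v\<close>-coin with output 0. The value \<open>w\<close> solves
  \<open>w = u + (1 - u) * (1 - v) * w\<close>, and the denominator is the probability that a pair
  of rounds decides the race.\<close>

lemma implementable_race:
  fixes u v :: "real^'n::finite \<Rightarrow> real"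
  assumes u: "bernoulli_implementable u" and v: "bernoulli_implementable v"
    and pos: "\<And>p. p \<in> unit_cube \<Longrightarrow> 0 < u p \<or> 0 < v p"
  shows "bernoulli_implementable (\<lambda>p. u p / (1 - (1 - u p) * (1 - v p)))"
proof -
  define w where "w p = u p / (1 - (1 - u p) * (1 - v p))" for p
  let ?a = "\<lambda>k :: nat. if even k then u else v" and ?b = "\<lambda>k p. of_bool (even (k::nat))"
  \<comment> \<open>From an odd round on, the \<open>v\<close>-coin must fail first before the race
    starts afresh.\<close>
  let ?r = "\<lambda>k :: nat. if even k then w else (\<lambda>p. (1 - v p) * w p)"
  have "bernoulli_implementable (?r 0)"
  proof (rule implementable_sequential[where a = ?a and b = ?b])
    show "bernoulli_implementable (?a k)" "bernoulli_implementable (?b k)" for k :: nat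
      using u v implementable_const[of 0] implementable_const[of 1] by auto
    fix p :: "real^'n" assume p: "p \<in> unit_cube"
    note u01 = implementable_bounds[OF u p] and v01 = implementable_bounds[OF v p]
    define q where "q = (1 - u p) * (1 - v p)"
    have q: "0 \<le> q" "q < 1" "u p \<le> 1 - q"
    proof -
      show "0 \<le> q" using u01 v01 by (simp add: q_def)
      have "q \<le> 1 - u p" "q \<le> 1 - v p"
        unfolding q_def using u01 v01 by (simp_all add: mult_left_le mult_left_le_one_le)
      then show "q < 1" "u p \<le> 1 - q" using pos[OF p] by auto
    qed
    have w: "w p = u p / (1 - q)" by (simp add: w_def q_def)
    have w01: "0 \<le> w p" "w p \<le> 1" unfolding w using u01 q by auto
    then have "(1 - v p) * w p \<le> 1" using v01 by (simp add: mult_le_one)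
    then show "0 \<le> ?r k p \<and> ?r k p \<le> 1" for k using w01 v01 by auto
    have "u p + q * w p = w p" unfolding w using q by (simp add: field_simps)
    then have "u p + (1 - u p) * ((1 - v p) * w p) = w p" by (simp add: q_def mult.assoc)
    then show "?r k p = ?a k p * ?b k p + (1 - ?a k p) * ?r (Suc k) p" for k by simp
    \<comment> \<open>Only even lengths have this closed form; monotonicity of the products covers
      the odd ones.\<close>
    have prod: "(\<Prod>j<2 * K. 1 - ?a j p) = q ^ K" for K
      by (induction K) (auto simp: q_def)
    have nonneg: "0 \<le> (\<Prod>j<K. 1 - ?a j p)" for K
      using u01 v01 by (intro prod_nonneg) auto
    have "(\<Prod>j<K. 1 - ?a j p) * (1 - ?a K p) \<le> (\<Prod>j<K. 1 - ?a j p)" for K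
      by (rule mult_left_le[OF _ nonneg]) (simp add: u01 v01)
    then have decseq: "decseq (\<lambda>K. \<Prod>j<K. 1 - ?a j p)"
      by (intro decseq_SucI) simp
    have decr: "(\<Prod>j<K. 1 - ?a j p) \<le> q ^ M" if "2 * M \<le> K" for K M
      unfolding prod[symmetric] by (rule decseqD[OF decseq that])
    have "\<exists>K0. \<forall>K\<ge>K0. \<bar>(\<Prod>j<K. 1 - ?a j p) - 0\<bar> < e" if e: "e > 0" for e
    proof -
      obtain M where M: "q ^ M < e" using real_arch_pow_inv[OF e q(2)] by blast
      have "\<bar>(\<Prod>j<K. 1 - ?a j p) - 0\<bar> < e" if "K \<ge> 2 * M" for K
        using nonneg[of K] decr[OF that] M by linarith
      then show ?thesis by blast
    qed
    then show "(\<lambda>K. \<Prod>j<K. 1 - ?a j p) \<longlonglongrightarrow> 0" by (simp add: LIMSEQ_iff)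
  qed
  then show ?thesis by (simp add: w_def[abs_def])
qed

section \<open>Continuity and polynomial boundedness of implementable functions\<close>

definition face_weight :: "'n::finite set \<Rightarrow> 'n set \<Rightarrow> 'n set \<Rightarrow> real^'n \<Rightarrow> real" where
  "face_weight A S B p = (\<Prod>i\<in>A. 1 - p$i) * (\<Prod>i\<in>S. p$i * (1 - p$i)) * (\<Prod>i\<in>B. p$i)"

definition face_triple :: "'n set \<Rightarrow> 'n set \<Rightarrow> 'n set \<Rightarrow> bool" where
  "face_triple A S B \<longleftrightarrow> A \<inter> S = {} \<and> A \<inter> B = {} \<and> S \<inter> B = {} \<and> A \<union> S \<union> B = UNIV"

lemma poly_bounded_iff:
  "poly_bounded f \<longleftrightarrow> (\<exists>m c. c > 0 \<and> (\<forall>A S B. face_triple A S B \<longrightarrow>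
     (\<exists>p\<in>open_face A S B. f p \<noteq> 0) \<longrightarrow> (\<forall>p\<in>unit_cube. c * face_weight A S B p ^ m \<le> f p)))"
  unfolding poly_bounded_def face_weight_def face_triple_def by blast

lemma implementable_face_weight: "bernoulli_implementable (face_weight A S B)"
  unfolding face_weight_def[abs_def]
  by (intro implementable_mult implementable_prod implementable_compl implementable_coin) auto

lemma prod_le_member:
  fixes g :: "'a \<Rightarrow> real"
  assumes "finite I" "i \<in> I" "\<And>j. j \<in> I \<Longrightarrow> 0 \<le> g j \<and> g j \<le> 1"
  shows "(\<Prod>j\<in>I. g j) \<le> g i"
proof -
  have "(\<Prod>j\<in>I. g j) = g i * (\<Prod>j\<in>I - {i}. g j)"
    using assms by (simp add: prod.remove)
  also have "\<dots> \<le> g i * 1"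
    using assms by (intro mult_left_mono prod_le_1) auto
  finally show ?thesis by simp
qed

text \<open>The last two bounds serve to compare coin flips with the weight: the coins in
  \<open>S \<union> B\<close> can give outcome 1 on the open face, those in
  \<open>A \<union> S\<close> outcome 0.\<close>

lemma face_weight_bounds:
  assumes p: "p \<in> unit_cube"
  shows "0 \<le> face_weight A S B p" "face_weight A S B p \<le> 1"
    "i \<in> S \<union> B \<Longrightarrow> face_weight A S B p \<le> p$i"
    "i \<in> A \<union> S \<Longrightarrow> face_weight A S B p \<le> 1 - p$i"
proof -
  have c: "0 \<le> p$j" "p$j \<le> 1" for j using p by (auto simp: unit_cube_def)
  then have c': "0 \<le> p$j * (1 - p$j)" "p$j * (1 - p$j) \<le> 1" "p$j * (1 - p$j) \<le> p$j"
    "p$j * (1 - p$j) \<le> 1 - p$j" for j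
    by (simp_all add: mult_le_one mult_left_le mult_left_le_one_le)
  show "0 \<le> face_weight A S B p" "face_weight A S B p \<le> 1"
    using implementable_bounds[OF implementable_face_weight p] by auto
  let ?a = "\<Prod>i\<in>A. 1 - p$i" and ?s = "\<Prod>i\<in>S. p$i * (1 - p$i)" and ?b = "\<Prod>i\<in>B. p$i"
  have bd: "0 \<le> ?a" "?a \<le> 1" "0 \<le> ?s" "?s \<le> 1" "0 \<le> ?b" "?b \<le> 1"
    using c c' by (auto intro!: prod_nonneg prod_le_1)
  have le: "face_weight A S B p \<le> ?a" "face_weight A S B p \<le> ?s" "face_weight A S B p \<le> ?b"
  proof -
    have "?a * ?s * ?b \<le> (?a * 1) * 1" using bd by (intro mult_mono) auto
    then show "face_weight A S B p \<le> ?a" by (simp add: face_weight_def)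
    have "?a * ?s * ?b \<le> (1 * ?s) * 1" using bd by (intro mult_mono) auto
    then show "face_weight A S B p \<le> ?s" by (simp add: face_weight_def)
    have "?a * ?s * ?b \<le> (1 * 1) * ?b" using bd by (intro mult_mono) auto
    then show "face_weight A S B p \<le> ?b" by (simp add: face_weight_def)
  qed
  show "face_weight A S B p \<le> p$i" if "i \<in> S \<union> B"
  proof (cases "i \<in> S")
    case True
    then have "?s \<le> p$i * (1 - p$i)" by (intro prod_le_member) (use c' in auto)
    then show ?thesis using le(2) c'(3)[of i] by linarith
  next
    case False
    then have "?b \<le> p$i" using that by (intro prod_le_member) (use c in auto)
    then show ?thesis using le(3) by linarith
  qed
  show "face_weight A S B p \<le> 1 - p$i" if "i \<in> A \<union> S"
  proof (cases "i \<in> S")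
    case True
    then have "?s \<le> p$i * (1 - p$i)" by (intro prod_le_member) (use c' in auto)
    then show ?thesis using le(2) c'(4)[of i] by linarith
  next
    case False
    then have "?a \<le> 1 - p$i" using that by (intro prod_le_member) (use c in auto)
    then show ?thesis using le(1) by linarith
  qed
qed

lemma face_weight_pos:
  assumes "p \<in> open_face A S B"
  shows "0 < face_weight A S B p"
  using assms unfolding face_weight_def open_face_def
  by (intro mult_pos_pos prod_pos) auto

lemma open_face_subset_cube:
  assumes "face_triple A S B"
  shows "open_face A S B \<subseteq> unit_cube"
proof
  fix p assume p: "p \<in> open_face A S B"
  have "0 \<le> p$i \<and> p$i \<le> 1" for i
  proof -
    have "i \<in> A \<or> i \<in> S \<or> i \<in> B" using assms by (auto simp: face_triple_def)
    then show ?thesis using p by (auto simp: open_face_def less_imp_le)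
  qed
  then show "p \<in> unit_cube" by (auto simp: unit_cube_def)
qed

lemma ex_open_face:
  fixes p :: "real^'n::finite"
  assumes "p \<in> unit_cube"
  obtains A S B where "face_triple A S B" "p \<in> open_face A S B"
proof
  show "face_triple {i. p$i = 0} {i. 0 < p$i \<and> p$i < 1} {i. p$i = 1}"
    using assms by (auto simp: face_triple_def unit_cube_def less_le)
  show "p \<in> open_face {i. p$i = 0} {i. 0 < p$i \<and> p$i < 1} {i. p$i = 1}"
    by (auto simp: open_face_def)
qed

text \<open>If coin \<open>i\<close> can give outcome \<open>x\<close> at one point of the face, the
  face weight contains the corresponding factor \<open>p$i\<close> or \<open>1 - p$i\<close>, and
  the other factors are at most 1. For a constant coin the weight is bounded by 1.\<close>

lemma flip_prob_face_weight:
  assumes F: "face_triple A S B" and q: "q \<in> open_face A S B" "0 < flip_prob l q x"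
    and l: "\<And>c. l = Cst c \<Longrightarrow> 0 < c \<and> c < 1"
  shows "\<exists>c>0. \<forall>p\<in>unit_cube. c * face_weight A S B p \<le> flip_prob l p x"
proof (cases l)
  case (Coin i)
  have "i \<in> A \<or> i \<in> S \<or> i \<in> B" using F by (auto simp: face_triple_def)
  then have "face_weight A S B p \<le> flip_prob l p x" if "p \<in> unit_cube" for p
    using face_weight_bounds(3,4)[OF that, of i S B A] face_weight_bounds(3,4)[OF that, of i A S B]
      q by (cases x) (auto simp: Coin open_face_def)
  then show ?thesis by (intro exI[of _ 1]) auto
next
  case (Cst c)
  have "flip_prob l q x * face_weight A S B p \<le> flip_prob l p x" if "p \<in> unit_cube" for p
  proof -
    have "flip_prob l q x * face_weight A S B p \<le> flip_prob l q x * 1"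
      using face_weight_bounds(2)[OF that] q(2) by (intro mult_left_mono) auto
    then show ?thesis by (simp add: Cst)
  qed
  then show ?thesis using q(2) by auto
qed (use q in auto)

text \<open>Follow a path to output \<open>b\<close> that has positive probability at
  \<open>q\<close>; each of its at most \<open>N\<close> flips costs one factor of the
  weight.\<close>

lemma out_prob_face_weight:
  fixes lab :: "'s \<Rightarrow> 'n::finite lbl"
  assumes cst: "\<And>s c. lab s = Cst c \<Longrightarrow> 0 < c \<and> c < 1"
    and F: "face_triple A S B" and q: "q \<in> open_face A S B" "0 < out_prob lab nx q b N s"
  shows "\<exists>c>0. \<forall>p\<in>unit_cube. c * face_weight A S B p ^ N \<le> out_prob lab nx p b N s"
  using q(2)
proof (induction N arbitrary: s)
  case 0
  then show ?case by (intro exI[of _ 1]) auto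
next
  case (Suc N)
  have mach: "bf_machine lab p" if "p \<in> unit_cube" for p
    using cst that by unfold_locales auto
  have q_cube: "q \<in> unit_cube" using q F open_face_subset_cube by blast
  show ?case
  proof (cases "lab s = Out b")
    case True
    then show ?thesis
      using face_weight_bounds(1,2) by (intro exI[of _ 1]) (auto intro!: power_le_one mult_le_one)
  next
    case False
    have "0 < flip_prob (lab s) q True * out_prob lab nx q b N (nx s True)
      \<or> 0 < flip_prob (lab s) q False * out_prob lab nx q b N (nx s False)"
      using Suc.prems False by (simp del: zero_less_mult_iff) linarith
    then obtain x where "0 < flip_prob (lab s) q x * out_prob lab nx q b N (nx s x)" by blast
    with bf_machine.flip_prob_nonneg[OF mach[OF q_cube], of s x]
    have x: "0 < flip_prob (lab s) q x" "0 < out_prob lab nx q b N (nx s x)"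
      by (auto simp: zero_less_mult_iff)
    obtain c where c: "c > 0" "\<And>p. p \<in> unit_cube \<Longrightarrow>
        c * face_weight A S B p ^ N \<le> out_prob lab nx p b N (nx s x)"
      using Suc.IH[OF x(2)] by blast
    obtain d where d: "d > 0" "\<And>p. p \<in> unit_cube \<Longrightarrow>
        d * face_weight A S B p \<le> flip_prob (lab s) p x"
      using flip_prob_face_weight[OF F q(1) x(1) cst[of s]] by blast
    have "d * c * face_weight A S B p ^ Suc N \<le> out_prob lab nx p b (Suc N) s"
      if p: "p \<in> unit_cube" for p
    proof -
      interpret bf_machine lab nx p by (rule mach[OF p])
      have "d * c * face_weight A S B p ^ Suc N
          = (d * face_weight A S B p) * (c * face_weight A S B p ^ N)" by simp
      also have "\<dots> \<le> flip_prob (lab s) p x * out_prob lab nx p b N (nx s x)"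
        using c(1) d(1) face_weight_bounds(1)[OF p] flip_prob_nonneg
        by (intro mult_mono c(2) d(2) p) auto
      also have "\<dots> \<le> out_prob lab nx p b (Suc N) s"
        using flip_prob_nonneg[of s True] flip_prob_nonneg[of s False]
          out_prob_nonneg[of b N "nx s True"] out_prob_nonneg[of b N "nx s False"]
        by (cases x) auto
      finally show ?thesis .
    qed
    then show ?thesis using c d by (intro exI[of _ "d * c"]) auto
  qed
qed

text \<open>Since the weights lie between 0 and 1, raising the exponent and shrinking the constant
  keep a bound valid; so exponents are added and the minimum of the constants is taken.\<close>

lemma uniform_power_bound:
  fixes w :: "'x \<Rightarrow> 'a \<Rightarrow> real"
  assumes "finite X" and w: "\<And>x a. x \<in> X \<Longrightarrow> a \<in> D \<Longrightarrow> 0 \<le> w x a \<and> w x a \<le> 1"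
    and "\<And>x. x \<in> X \<Longrightarrow> \<exists>m c. c > 0 \<and> (\<forall>a\<in>D. c * w x a ^ m \<le> f a)"
  shows "\<exists>(m::nat) c. c > 0 \<and> (\<forall>x\<in>X. \<forall>a\<in>D. c * w x a ^ m \<le> f a)"
  using assms
proof (induction X)
  case empty
  then show ?case by (auto intro: exI[of _ 1])
next
  case (insert x X)
  obtain m c where m: "c > 0" "\<And>y a. y \<in> X \<Longrightarrow> a \<in> D \<Longrightarrow> c * w y a ^ m \<le> f a"
    using insert.IH[OF insert.prems(1)[OF insertI2] insert.prems(2)[OF insertI2]] by blast
  obtain m' c' where m': "c' > 0" "\<And>a. a \<in> D \<Longrightarrow> c' * w x a ^ m' \<le> f a"
    using insert.prems(2)[of x] by blast
  have "min c c' * w y a ^ (m + m') \<le> f a" if "y \<in> insert x X" "a \<in> D" for y a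
  proof (cases "y = x")
    case True
    have "min c c' * w y a ^ (m + m') \<le> c' * w y a ^ m'"
      using insert.prems(1)[OF that] m' m by (intro mult_mono power_decreasing) auto
    then show ?thesis using m'(2)[OF that(2)] True by simp
  next
    case False
    have "min c c' * w y a ^ (m + m') \<le> c * w y a ^ m"
      using insert.prems(1)[OF that] m' m by (intro mult_mono power_decreasing) auto
    then show ?thesis using m(2)[of y a] that False by fastforce
  qed
  then show ?case using m(1) m'(1) by (intro exI[of _ "m + m'"] exI[of _ "min c c'"]) auto
qed

text \<open>On a face where \<open>f\<close> does not vanish identically, some finite number of
  flips already gives output 1 with positive probability. As there are finitely many faces, the
  resulting bounds can be made uniform.\<close>

lemma implementable_imp_poly_bounded:
  fixes f :: "real^'n::finite \<Rightarrow> real"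
  assumes f: "bernoulli_implementable f"
  shows "poly_bounded f"
proof -
  obtain t where t: "valid_bf t" "\<And>p. p \<in> unit_cube \<Longrightarrow> tree_out t p True \<longlonglongrightarrow> f p"
    using f unfolding bernoulli_implementable_iff by blast
  let ?X = "{(A, S, B). face_triple A S B \<and> (\<exists>p\<in>open_face A S B. f p \<noteq> 0)}"
  let ?w = "\<lambda>(A, S, B). face_weight A S B"
  have "\<exists>m c. c > 0 \<and> (\<forall>X\<in>?X. \<forall>p\<in>unit_cube. c * ?w X p ^ m \<le> f p)"
  proof (rule uniform_power_bound)
    show "0 \<le> ?w X p \<and> ?w X p \<le> 1" if "p \<in> unit_cube" for X p
      using face_weight_bounds(1,2)[OF that] by (auto split: prod.splits)
    show "\<exists>m c. c > 0 \<and> (\<forall>p\<in>unit_cube. c * ?w X p ^ m \<le> f p)" if "X \<in> ?X" for X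
    proof -
      obtain A S B q where X: "X = (A, S, B)" "face_triple A S B" "q \<in> open_face A S B" "f q \<noteq> 0"
        using \<open>X \<in> ?X\<close> by auto
      have q: "q \<in> unit_cube" using X open_face_subset_cube by blast
      have "f q > 0" using implementable_bounds[OF f q] X(4) by linarith
      from order_tendstoD(1)[OF t(2)[OF q] this] obtain N where N: "tree_out t q True N > 0"
        unfolding eventually_sequentially by blast
      obtain c where c: "c > 0" "\<forall>p\<in>unit_cube. c * face_weight A S B p ^ N \<le> tree_out t p True N"
        using out_prob_face_weight[OF _ X(2,3) N] t(1) unfolding valid_bf_def by blast
      have "c * ?w X p ^ N \<le> f p" if p: "p \<in> unit_cube" for p
        using incseq_le[OF bf_machine.incseq_out_prob[OF machine_tree[OF t(1) p]] t(2)[OF p], of N]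
          c(2)[rule_format, OF p] unfolding X(1) prod.case by linarith
      then show ?thesis using c(1) by blast
    qed
  qed simp
  then show ?thesis unfolding poly_bounded_iff by force
qed

lemma continuous_on_out_prob:
  fixes lab :: "'s \<Rightarrow> 'n::finite lbl"
  shows "continuous_on UNIV (\<lambda>p. out_prob lab nx p b N s)"
proof (induction N arbitrary: s)
  case (Suc N)
  have "continuous_on UNIV (\<lambda>p. flip_prob l p x)" for l :: "'n lbl" and x
    by (cases l; cases x) (auto intro!: continuous_intros)
  then show ?case using Suc by (auto intro!: continuous_intros)
qed auto

text \<open>A truncated output probability exceeding \<open>e\<close> at \<open>p\<close> does so
  near \<open>p\<close> by continuity, and it stays below \<open>f\<close>.\<close>

lemma implementable_lower_semicontinuous:
  assumes f: "bernoulli_implementable f" and p: "p \<in> unit_cube" and e: "e < f p"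
  shows "\<forall>\<^sub>F q in at p within unit_cube. e < f q"
proof -
  obtain t where t: "valid_bf t" "\<And>p. p \<in> unit_cube \<Longrightarrow> tree_out t p True \<longlonglongrightarrow> f p"
    using f unfolding bernoulli_implementable_iff by blast
  obtain N where N: "e < tree_out t p True N"
    using order_tendstoD(1)[OF t(2)[OF p] e] unfolding eventually_sequentially by blast
  have "continuous_on unit_cube (\<lambda>p. tree_out t p True N)"
    by (rule continuous_on_subset[OF continuous_on_out_prob subset_UNIV])
  then have "((\<lambda>q. tree_out t q True N) \<longlongrightarrow> tree_out t p True N) (at p within unit_cube)"
    using p by (simp add: continuous_on_def)
  from order_tendstoD(1)[OF this N] have "\<forall>\<^sub>F q in at p within unit_cube. e < tree_out t q True N" .
  moreover have "\<forall>\<^sub>F q in at p within unit_cube. q \<in> unit_cube"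
    by (simp add: eventually_at_filter)
  ultimately show ?thesis
  proof eventually_elim
    case (elim q)
    then show ?case
      using incseq_le[OF bf_machine.incseq_out_prob[OF machine_tree[OF t(1)]] t(2), of q N] by linarith
  qed
qed

text \<open>Upper semicontinuity of \<open>f\<close> is lower semicontinuity of
  \<open>1 - f\<close>.\<close>

lemma implementable_imp_continuous:
  fixes f :: "real^'n::finite \<Rightarrow> real"
  assumes f: "bernoulli_implementable f"
  shows "continuous_on unit_cube f"
  unfolding continuous_on_def
proof (intro ballI order_tendstoI)
  fix p :: "real^'n" and e assume p: "p \<in> unit_cube"
  show "\<forall>\<^sub>F q in at p within unit_cube. e < f q" if "e < f p"
    using implementable_lower_semicontinuous[OF f p that] .
  show "\<forall>\<^sub>F q in at p within unit_cube. f q < e" if "f p < e"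
    using implementable_lower_semicontinuous[OF implementable_compl[OF f] p, of "1 - e"] that by simp
qed

section \<open>Uniform approximation by implementable functions\<close>

text \<open>Condition the number of successes in \<open>Suc n\<close> flips on one flip: its success
  shifts the argument of \<open>h\<close> by one.\<close>

lemma sum_Bernstein_Suc:
  "(\<Sum>k\<le>Suc n. h k * Bernstein (Suc n) k x)
    = x * (\<Sum>k\<le>n. h (Suc k) * Bernstein n k x) + (1 - x) * (\<Sum>k\<le>n. h k * Bernstein n k x)"
proof -
  have split: "Bernstein (Suc n) (Suc k) x = x * Bernstein n k x + (1 - x) * Bernstein n (Suc k) x"
    if "k \<le> n" for k
  proof (cases "k = n")
    case False
    then have "n - k = Suc (n - Suc k)" using that by simp
    then show ?thesis by (simp add: Bernstein_def algebra_simps)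
  qed (simp add: Bernstein_def)
  have last: "Bernstein n (Suc n) x = 0" by (simp add: Bernstein_def)
  have "(\<Sum>k\<le>Suc n. h k * Bernstein (Suc n) k x)
      = h 0 * Bernstein (Suc n) 0 x + (\<Sum>k\<le>n. h (Suc k) * Bernstein (Suc n) (Suc k) x)"
    by (rule sum.atMost_Suc_shift)
  also have "(\<Sum>k\<le>n. h (Suc k) * Bernstein (Suc n) (Suc k) x)
      = (\<Sum>k\<le>n. x * (h (Suc k) * Bernstein n k x) + (1 - x) * (h (Suc k) * Bernstein n (Suc k) x))"
    by (intro sum.cong refl, subst split) (auto simp: algebra_simps)
  also have "\<dots> = x * (\<Sum>k\<le>n. h (Suc k) * Bernstein n k x)
      + (1 - x) * (\<Sum>k\<le>n. h (Suc k) * Bernstein n (Suc k) x)"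
    by (simp add: sum.distrib sum_distrib_left)
  also have "h 0 * Bernstein (Suc n) 0 x = (1 - x) * (h 0 * Bernstein n 0 x)"
    by (simp add: Bernstein_def)
  also have "(1 - x) * (h 0 * Bernstein n 0 x) + (x * (\<Sum>k\<le>n. h (Suc k) * Bernstein n k x)
      + (1 - x) * (\<Sum>k\<le>n. h (Suc k) * Bernstein n (Suc k) x))
     = x * (\<Sum>k\<le>n. h (Suc k) * Bernstein n k x)
       + (1 - x) * (h 0 * Bernstein n 0 x + (\<Sum>k\<le>n. h (Suc k) * Bernstein n (Suc k) x))"
    by (simp add: distrib_left)
  also have "h 0 * Bernstein n 0 x + (\<Sum>k\<le>n. h (Suc k) * Bernstein n (Suc k) x)
      = (\<Sum>k\<le>Suc n. h k * Bernstein n k x)"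
    by (rule sum.atMost_Suc_shift[symmetric])
  also have "\<dots> = (\<Sum>k\<le>n. h k * Bernstein n k x)"
    by (simp add: last)
  finally show ?thesis .
qed

text \<open>The experiment flips the \<open>w\<close>-coin \<open>n\<close> times and then, after
  \<open>k\<close> successes, an \<open>h k\<close>-coin.\<close>

lemma implementable_Bernstein:
  assumes w: "bernoulli_implementable w" and h: "\<And>k. 0 \<le> h k \<and> h k \<le> 1"
  shows "bernoulli_implementable (\<lambda>p. \<Sum>k\<le>n. h k * Bernstein n k (w p))"
  using h
proof (induction n arbitrary: h)
  case 0
  then show ?case by (simp add: Bernstein_def implementable_const)
next
  case (Suc n)
  show ?case
    unfolding sum_Bernstein_Suc by (intro implementable_mix w Suc)
qed

text \<open>Implementable functions have values in \<open>[0, 1]\<close> and thus do not form an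
  algebra; their affine images on the cube do, as Stone-Weierstrass requires.\<close>

definition affine_implementable :: "(real^'n::finite \<Rightarrow> real) \<Rightarrow> bool" where
  "affine_implementable F \<longleftrightarrow> (\<exists>g \<alpha> \<beta>. bernoulli_implementable g \<and> \<alpha> > 0 \<and>
     (\<forall>p\<in>unit_cube. F p = \<alpha> * g p + \<beta>))"

lemma affine_implementableI:
  "bernoulli_implementable g \<Longrightarrow> \<alpha> > 0 \<Longrightarrow> (\<And>p. p \<in> unit_cube \<Longrightarrow> F p = \<alpha> * g p + \<beta>) \<Longrightarrow>
    affine_implementable F"
  unfolding affine_implementable_def by blast

lemma affine_implementable_const: "affine_implementable (\<lambda>_. c)"
  by (rule affine_implementableI[of "\<lambda>_. 0" 1 _ c]) (simp_all add: implementable_const)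

lemma affine_implementable_implementable:
  "bernoulli_implementable g \<Longrightarrow> affine_implementable g"
  by (rule affine_implementableI[of _ 1 _ 0]) auto

lemma affine_implementable_add:
  fixes F G :: "real^'n::finite \<Rightarrow> real"
  assumes "affine_implementable F" "affine_implementable G"
  shows "affine_implementable (\<lambda>p. F p + G p)"
proof -
  obtain g \<alpha> \<beta> where F: "bernoulli_implementable g" "\<alpha> > 0" "\<And>p. p \<in> unit_cube \<Longrightarrow> F p = \<alpha> * g p + \<beta>"
    using assms unfolding affine_implementable_def by blast
  obtain h \<gamma> \<delta> where G: "bernoulli_implementable h" "\<gamma> > 0" "\<And>p. p \<in> unit_cube \<Longrightarrow> G p = \<gamma> * h p + \<delta>"
    using assms unfolding affine_implementable_def by blast
  \<comment> \<open>The scale factors, normalised to a convex combination that a constant coin can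
    realise.\<close>
  define s where "s = \<alpha> / (\<alpha> + \<gamma>)"
  have s: "0 \<le> s" "s \<le> 1" "(\<alpha> + \<gamma>) * s = \<alpha>" "(\<alpha> + \<gamma>) * (1 - s) = \<gamma>"
    using F(2) G(2) by (auto simp: s_def field_simps)
  show ?thesis
  proof (rule affine_implementableI)
    show "bernoulli_implementable (\<lambda>p. s * g p + (1 - s) * h p)"
      by (intro implementable_mix[where w = "\<lambda>_. s"] implementable_const s F G)
    show "\<alpha> + \<gamma> > 0" using F G by simp
    fix p :: "real^'n" assume p: "p \<in> unit_cube"
    have "(\<alpha> + \<gamma>) * (s * g p + (1 - s) * h p) = ((\<alpha> + \<gamma>) * s) * g p + ((\<alpha> + \<gamma>) * (1 - s)) * h p"
      by (simp only: distrib_left mult.assoc)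
    then show "F p + G p = (\<alpha> + \<gamma>) * (s * g p + (1 - s) * h p) + (\<beta> + \<delta>)"
      unfolding s F(3)[OF p] G(3)[OF p] by simp
  qed
qed

lemma affine_implementable_scale:
  fixes F :: "real^'n::finite \<Rightarrow> real"
  assumes "affine_implementable F"
  shows "affine_implementable (\<lambda>p. c * F p)"
proof -
  obtain g \<alpha> \<beta> where F: "bernoulli_implementable g" "\<alpha> > 0" "\<And>p. p \<in> unit_cube \<Longrightarrow> F p = \<alpha> * g p + \<beta>"
    using assms unfolding affine_implementable_def by blast
  consider "c = 0" | "c > 0" | "c < 0" by linarith
  then show ?thesis
  proof cases
    case 1
    then show ?thesis using affine_implementable_const[of 0] by simp
  next
    case 2
    then show ?thesis
      using F by (intro affine_implementableI[of g "c * \<alpha>" _ "c * \<beta>"]) (auto simp: algebra_simps)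
  next
    case 3
    then show ?thesis
      \<comment> \<open>A negative factor is absorbed by the complement, which keeps the scale
        positive: \<open>c * \<alpha> * g = - c * \<alpha> * (1 - g) + c * \<alpha>\<close>.\<close>
      using F by (intro affine_implementableI[OF implementable_compl[OF F(1)], of "- c * \<alpha>" _ "c * \<alpha> + c * \<beta>"])
        (auto simp: algebra_simps mult_pos_neg)
  qed
qed

lemma affine_implementable_mult:
  fixes F G :: "real^'n::finite \<Rightarrow> real"
  assumes "affine_implementable F" "affine_implementable G"
  shows "affine_implementable (\<lambda>p. F p * G p)"
proof -
  obtain g \<alpha> \<beta> where F: "bernoulli_implementable g" "\<alpha> > 0" "\<And>p. p \<in> unit_cube \<Longrightarrow> F p = \<alpha> * g p + \<beta>"
    using assms unfolding affine_implementable_def by blast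
  obtain h \<gamma> \<delta> where G: "bernoulli_implementable h" "\<gamma> > 0" "\<And>p. p \<in> unit_cube \<Longrightarrow> G p = \<gamma> * h p + \<delta>"
    using assms unfolding affine_implementable_def by blast
  have "affine_implementable (\<lambda>p. (\<alpha> * \<gamma>) * (g p * h p) + ((\<alpha> * \<delta>) * g p + ((\<beta> * \<gamma>) * h p + \<beta> * \<delta>)))"
    by (intro affine_implementable_add affine_implementable_scale affine_implementable_const
        affine_implementable_implementable implementable_mult F G)
  moreover have "F p * G p = (\<alpha> * \<gamma>) * (g p * h p) + ((\<alpha> * \<delta>) * g p + ((\<beta> * \<gamma>) * h p + \<beta> * \<delta>))"
    if "p \<in> unit_cube" for p
    unfolding F(3)[OF that] G(3)[OF that] by (simp add: algebra_simps)
  ultimately show ?thesis unfolding affine_implementable_def by simp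
qed

lemma affine_implementable_continuous:
  assumes "affine_implementable F"
  shows "continuous_on unit_cube F"
proof -
  obtain g \<alpha> \<beta> where F: "bernoulli_implementable g" "\<And>p. p \<in> unit_cube \<Longrightarrow> F p = \<alpha> * g p + \<beta>"
    using assms unfolding affine_implementable_def by blast
  have "continuous_on unit_cube (\<lambda>p. \<alpha> * g p + \<beta>)"
    by (intro continuous_intros implementable_imp_continuous F)
  then show ?thesis using F(2) by (simp cong: continuous_on_cong)
qed

lemma unit_cube_eq_cbox: "unit_cube = (cbox 0 1 :: (real^'n::finite) set)"
  by (auto simp: unit_cube_def mem_box_cart)

lemma compact_unit_cube: "compact (unit_cube :: (real^'n::finite) set)"
  unfolding unit_cube_eq_cbox by (rule compact_cbox)

text \<open>Stone--Weierstrass only provides an affine image of an implementable function, which may leave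
  \<open>[0, 1]\<close>. The clamped affine map is therefore applied to it through its Bernstein polynomials.\<close>

lemma implementable_approx:
  fixes f :: "real^'n::finite \<Rightarrow> real"
  assumes f: "continuous_on unit_cube f" "\<And>p. p \<in> unit_cube \<Longrightarrow> 0 \<le> f p \<and> f p \<le> 1" and e: "e > 0"
  obtains b where "bernoulli_implementable b" "\<And>p. p \<in> unit_cube \<Longrightarrow> \<bar>b p - f p\<bar> \<le> e"
proof -
  interpret function_ring_on "Collect affine_implementable" "unit_cube :: (real^'n) set"
  proof
    show "\<exists>F\<in>Collect affine_implementable. F p \<noteq> F q" if "p \<noteq> q" for p q :: "real^'n"
    proof -
      obtain i where "p$i \<noteq> q$i" using \<open>p \<noteq> q\<close> by (auto simp: vec_eq_iff)
      then show ?thesis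
        by (intro bexI[of _ "\<lambda>p. p$i"])
           (auto intro: affine_implementable_implementable implementable_coin)
    qed
  qed (auto intro: compact_unit_cube affine_implementable_continuous affine_implementable_add
        affine_implementable_mult affine_implementable_const)
  \<comment> \<open>Half of the error is spent here, the other half on the Bernstein
    polynomial.\<close>
  obtain F where "affine_implementable F" and F: "\<And>p. p \<in> unit_cube \<Longrightarrow> \<bar>f p - F p\<bar> < e / 2"
    using Stone_Weierstrass_basic[OF f(1), of "e / 2"] e by auto
  then obtain g \<alpha> \<beta> where g: "bernoulli_implementable g" "\<And>p. p \<in> unit_cube \<Longrightarrow> F p = \<alpha> * g p + \<beta>"
    unfolding affine_implementable_def by blast
  define \<psi> where "\<psi> x = max 0 (min 1 (\<alpha> * x + \<beta>))" for x :: real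
  have "continuous_on {0..1} \<psi>"
    unfolding \<psi>_def by (intro continuous_intros)
  from Bernstein_Weierstrass[OF this, of "e / 2"] e obtain n where
    n: "\<And>x. x \<in> {0..1} \<Longrightarrow> \<bar>\<psi> x - (\<Sum>k\<le>n. \<psi> (k / n) * Bernstein n k x)\<bar> < e / 2"
    by (metis half_gt_zero order_refl)
  show ?thesis
  proof
    show "bernoulli_implementable (\<lambda>p. \<Sum>k\<le>n. \<psi> (k / n) * Bernstein n k (g p))"
      by (intro implementable_Bernstein g) (auto simp: \<psi>_def)
    fix p :: "real^'n" assume p: "p \<in> unit_cube"
    \<comment> \<open>As \<open>f p\<close> lies in \<open>[0, 1]\<close>, clamping does not
      increase the distance to it.\<close>
    have "\<bar>\<psi> (g p) - f p\<bar> \<le> \<bar>F p - f p\<bar>"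
      using f(2)[OF p] unfolding \<psi>_def g(2)[OF p] by (auto simp: max_def min_def)
    moreover have "\<bar>\<psi> (g p) - (\<Sum>k\<le>n. \<psi> (k / n) * Bernstein n k (g p))\<bar> < e / 2"
      using implementable_bounds[OF g(1) p] by (intro n) simp
    ultimately show "\<bar>(\<Sum>k\<le>n. \<psi> (k / n) * Bernstein n k (g p)) - f p\<bar> \<le> e"
      using F[OF p] by linarith
  qed
qed

section \<open>Implementable minorants\<close>

text \<open>Take a convex combination of the lower bounds belonging to the faces on which \<open>f\<close> does not vanish.\<close>

lemma poly_bounded_minorant:
  fixes f :: "real^'n::finite \<Rightarrow> real"
  assumes f: "poly_bounded f" "\<And>p. p \<in> unit_cube \<Longrightarrow> 0 \<le> f p"
  obtains u where "bernoulli_implementable u" "\<And>p. p \<in> unit_cube \<Longrightarrow> u p \<le> f p"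
    "\<And>p. p \<in> unit_cube \<Longrightarrow> 0 < f p \<Longrightarrow> 0 < u p"
proof -
  obtain m c where c: "c > 0" and mc: "\<And>A S B p. face_triple A S B \<Longrightarrow> \<exists>q\<in>open_face A S B. f q \<noteq> 0 \<Longrightarrow>
      p \<in> unit_cube \<Longrightarrow> c * face_weight A S B p ^ m \<le> f p"
    using f(1) unfolding poly_bounded_iff by blast
  \<comment> \<open>Capped at 1 so that \<open>d\<close> can serve as a coin.\<close>
  define d where "d = min c 1"
  have d: "0 < d" "d \<le> 1" "d \<le> c" using c by (auto simp: d_def)
  let ?X = "{(A, S, B). face_triple A S B \<and> (\<exists>p\<in>open_face A S B. f p \<noteq> 0)}"
  define w :: "'n set \<times> 'n set \<times> 'n set \<Rightarrow> real^'n \<Rightarrow> real" where "w = (\<lambda>(A, S, B). face_weight A S B)"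
  have w_impl: "bernoulli_implementable (w X)" for X
    by (cases X) (simp add: w_def implementable_face_weight)
  have le: "d * w X p ^ m \<le> f p" if "X \<in> ?X" "p \<in> unit_cube" for X p
  proof -
    have "d * w X p ^ m \<le> c * w X p ^ m"
      using implementable_bounds(1)[OF w_impl that(2)] d by (intro mult_right_mono zero_le_power)
    also have "\<dots> \<le> f p" using mc that by (cases X) (auto simp: w_def)
    finally show ?thesis .
  qed
  have "\<exists>u. bernoulli_implementable u \<and> (\<forall>p\<in>unit_cube. u p \<le> f p) \<and>
      (\<forall>p\<in>unit_cube. (\<exists>X\<in>Y. 0 < w X p) \<longrightarrow> 0 < u p)" if "finite Y" "Y \<subseteq> ?X" for Y
    using that
  proof (induction Y)
    case empty
    show ?case using f(2) implementable_const[of 0] by (intro exI[of _ "\<lambda>_. 0"]) auto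
  next
    case (insert X Y)
    then have XY: "Y \<subseteq> ?X" "X \<in> ?X" by simp_all
    from insert.IH[OF XY(1)] obtain u where u: "bernoulli_implementable u" "\<And>p. p \<in> unit_cube \<Longrightarrow> u p \<le> f p"
      "\<And>p Z. p \<in> unit_cube \<Longrightarrow> Z \<in> Y \<Longrightarrow> 0 < w Z p \<Longrightarrow> 0 < u p"
      by blast
    \<comment> \<open>Averaging two minorants gives a minorant that is positive wherever one of them
      is.\<close>
    let ?v = "\<lambda>p. 1 / 2 * u p + (1 - 1 / 2) * (d * w X p ^ m)"
    have "bernoulli_implementable ?v"
      using d by (intro implementable_mix[where w = "\<lambda>_. 1 / 2"] implementable_const u implementable_mult
          implementable_power w_impl) auto
    moreover have "?v p \<le> f p" if "p \<in> unit_cube" for p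
      using u(2)[OF that] le[OF XY(2) that] by simp
    moreover have "0 < ?v p" if "p \<in> unit_cube" "Z \<in> insert X Y" "0 < w Z p" for p Z
    proof -
      have nonneg: "0 \<le> u p" "0 \<le> d * w X p ^ m"
        using implementable_bounds(1)[OF u(1) that(1)] implementable_bounds(1)[OF w_impl that(1)] d by auto
      have "0 < u p + d * w X p ^ m"
      proof (cases "Z = X")
        case True
        then have "0 < d * w X p ^ m" using that d by simp
        then show ?thesis by (rule add_nonneg_pos[OF nonneg(1)])
      next
        case False
        then have "0 < u p" using u(3) that by blast
        then show ?thesis using nonneg(2) by (rule add_pos_nonneg)
      qed
      then show ?thesis by simp
    qed
    ultimately show ?case by blast
  qed
  from this[OF finite order_refl] obtain u where u: "bernoulli_implementable u" "\<And>p. p \<in> unit_cube \<Longrightarrow> u p \<le> f p"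
    "\<And>p X. p \<in> unit_cube \<Longrightarrow> X \<in> ?X \<Longrightarrow> 0 < w X p \<Longrightarrow> 0 < u p"
    by blast
  show ?thesis
  proof (rule that[OF u(1,2)])
    fix p :: "real^'n" assume p: "p \<in> unit_cube" "0 < f p"
    \<comment> \<open>The open face containing \<open>p\<close> itself has positive weight at
      \<open>p\<close>, and \<open>f\<close> does not vanish on it.\<close>
    obtain A S B where F: "face_triple A S B" "p \<in> open_face A S B"
      using ex_open_face[OF p(1)] by blast
    have "(A, S, B) \<in> ?X" using F p(2) by force
    moreover have "0 < w (A, S, B) p" using face_weight_pos[OF F(2)] by (simp add: w_def)
    ultimately show "0 < u p" using u(3)[OF p(1)] by blast
  qed
qed

section \<open>Implementability of continuous polynomially bounded functions\<close>

text \<open>Zeros of \<open>f\<close> are zeros of \<open>h\<close>, so every face that imposes a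
  bound on \<open>h\<close> already imposes one on \<open>f\<close>.\<close>

lemma poly_bounded_transfer:
  fixes f h :: "real^'n::finite \<Rightarrow> real"
  assumes f: "poly_bounded f" and d: "d > 0" "\<And>p. p \<in> unit_cube \<Longrightarrow> d * f p \<le> h p"
    and zero: "\<And>p. p \<in> unit_cube \<Longrightarrow> f p = 0 \<Longrightarrow> h p = 0"
  shows "poly_bounded h"
proof -
  obtain m c where c: "c > 0" and mc: "\<And>A S B p. face_triple A S B \<Longrightarrow> \<exists>q\<in>open_face A S B. f q \<noteq> 0 \<Longrightarrow>
      p \<in> unit_cube \<Longrightarrow> c * face_weight A S B p ^ m \<le> f p"
    using f unfolding poly_bounded_iff by blast
  have "d * c * face_weight A S B p ^ m \<le> h p"
    if F: "face_triple A S B" and q: "q \<in> open_face A S B" "h q \<noteq> 0" and p: "p \<in> unit_cube" for A S B p q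
  proof -
    have "f q \<noteq> 0" using zero[of q] q open_face_subset_cube[OF F] by blast
    then have "c * face_weight A S B p ^ m \<le> f p" using mc[OF F _ p] q(1) by blast
    then have "d * (c * face_weight A S B p ^ m) \<le> d * f p" using d(1) by (intro mult_left_mono) auto
    then show ?thesis using d(2)[OF p] by (simp add: mult.assoc)
  qed
  then show ?thesis
    unfolding poly_bounded_iff using c d(1) by (intro exI[of _ m] exI[of _ "d * c"]) auto
qed

lemma cube_positive_lower_bound:
  fixes h :: "real^'n::finite \<Rightarrow> real"
  assumes "continuous_on unit_cube h" "\<And>p. p \<in> unit_cube \<Longrightarrow> 0 < h p"
  obtains c where "c > 0" "\<And>p. p \<in> unit_cube \<Longrightarrow> c \<le> h p"
proof -
  have "(0 :: real^'n) \<in> unit_cube" by (simp add: unit_cube_def)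
  then obtain q where "q \<in> unit_cube" "\<forall>p\<in>unit_cube. h q \<le> h p"
    using continuous_attains_inf[OF compact_unit_cube _ assms(1)] by blast
  then show ?thesis using assms(2) that by blast
qed

text \<open>For minorants \<open>u\<close> of \<open>f\<close> and \<open>v\<close> of
  \<open>1 - f\<close>, let \<open>w\<close> be the probability that \<open>u\<close> wins the race
  and \<open>s\<close> the probability that one pair of flips decides it. Then
  \<open>s * w = u\<close> and \<open>s * (1 - w) = v * (1 - u)\<close>, and \<open>s\<close> is
  bounded below on the cube.\<close>

lemma ex_implementable_separator:
  fixes f :: "real^'n::finite \<Rightarrow> real"
  assumes f: "\<And>p. p \<in> unit_cube \<Longrightarrow> 0 \<le> f p \<and> f p \<le> 1"
    and pb: "poly_bounded f" "poly_bounded (\<lambda>p. 1 - f p)"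
  obtains w \<sigma> where "bernoulli_implementable w" "\<sigma> > 0"
    "\<And>p. p \<in> unit_cube \<Longrightarrow> \<sigma> * w p \<le> f p" "\<And>p. p \<in> unit_cube \<Longrightarrow> \<sigma> * (1 - w p) \<le> 1 - f p"
    "\<And>p. p \<in> unit_cube \<Longrightarrow> 0 < f p \<Longrightarrow> 0 < w p" "\<And>p. p \<in> unit_cube \<Longrightarrow> f p < 1 \<Longrightarrow> w p < 1"
proof -
  obtain u where u: "bernoulli_implementable u" "\<And>p. p \<in> unit_cube \<Longrightarrow> u p \<le> f p"
    "\<And>p. p \<in> unit_cube \<Longrightarrow> 0 < f p \<Longrightarrow> 0 < u p"
    using poly_bounded_minorant[OF pb(1)] f by blast
  obtain v where v: "bernoulli_implementable v" "\<And>p. p \<in> unit_cube \<Longrightarrow> v p \<le> 1 - f p"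
    "\<And>p. p \<in> unit_cube \<Longrightarrow> 0 < 1 - f p \<Longrightarrow> 0 < v p"
    using poly_bounded_minorant[OF pb(2)] f by (metis diff_ge_0_iff_ge)
  define s where "s p = 1 - (1 - u p) * (1 - v p)" for p
  have s: "s p = u p + v p * (1 - u p)" "s p = v p + u p * (1 - v p)" for p
    by (simp_all add: s_def algebra_simps)
  have pos: "0 < u p \<or> 0 < v p" if "p \<in> unit_cube" for p
    using u(3)[OF that] v(3)[OF that] f[OF that] by linarith
  have s_pos: "0 < s p" if p: "p \<in> unit_cube" for p
    using pos[OF p]
  proof
    assume "0 < u p"
    then show ?thesis
      unfolding s(1) using implementable_bounds[OF u(1) p] implementable_bounds[OF v(1) p]
      by (intro add_pos_nonneg) auto
  next
    assume "0 < v p"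
    then show ?thesis
      unfolding s(2) using implementable_bounds[OF u(1) p] implementable_bounds[OF v(1) p]
      by (intro add_pos_nonneg) auto
  qed
  have "continuous_on unit_cube s"
    unfolding s_def by (intro continuous_intros implementable_imp_continuous u v)
  then obtain \<sigma> where \<sigma>: "\<sigma> > 0" "\<And>p. p \<in> unit_cube \<Longrightarrow> \<sigma> \<le> s p"
    using cube_positive_lower_bound s_pos by blast
  define w where "w p = u p / s p" for p
  have w: "bernoulli_implementable w"
    using implementable_race[OF u(1) v(1) pos] by (simp add: w_def[abs_def] s_def)
  have sw: "s p * w p = u p" "s p * (1 - w p) = v p * (1 - u p)" if "p \<in> unit_cube" for p
  proof -
    show sw: "s p * w p = u p" using s_pos[OF that] by (simp add: w_def)
    have "s p * (1 - w p) = s p - s p * w p" by (simp add: right_diff_distrib)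
    then show "s p * (1 - w p) = v p * (1 - u p)" using sw s(1)[of p] by linarith
  qed
  show ?thesis
  proof (rule that[OF w \<sigma>(1)])
    fix p :: "real^'n" assume p: "p \<in> unit_cube"
    note bd = implementable_bounds[OF u(1) p] implementable_bounds[OF v(1) p] implementable_bounds[OF w p]
    have "\<sigma> * w p \<le> s p * w p" using bd \<sigma>(2)[OF p] by (intro mult_right_mono) auto
    then show "\<sigma> * w p \<le> f p" using sw(1)[OF p] u(2)[OF p] by linarith
    have "\<sigma> * (1 - w p) \<le> s p * (1 - w p)" using bd \<sigma>(2)[OF p] by (intro mult_right_mono) auto
    also have "\<dots> \<le> v p" unfolding sw(2)[OF p] using bd by (intro mult_left_le) auto
    finally show "\<sigma> * (1 - w p) \<le> 1 - f p" using v(2)[OF p] by linarith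
    show "0 < w p" if "0 < f p"
      using u(3)[OF p that] s_pos[OF p] by (simp add: w_def)
    show "w p < 1" if "f p < 1"
    proof -
      \<comment> \<open>Here \<open>v p > 0\<close> because \<open>1 - f p > 0\<close>, and
        \<open>u p \<le> f p < 1\<close>.\<close>
      have "0 < v p * (1 - u p)" using v(3)[OF p] u(2)[OF p] that by (intro mult_pos_pos) auto
      then have "0 < s p * (1 - w p)" using sw(2)[OF p] by simp
      then show ?thesis using s_pos[OF p] by (simp add: zero_less_mult_iff)
    qed
  qed
qed

text \<open>\<open>D\<close> is the probability of disagreement for positive \<open>m\<close>. If
  \<open>f \<ge> \<epsilon>\<close>, then \<open>b \<le> 2 * f\<close> and \<open>D \<le> 1\<close>
  give \<open>2 * f + 2 * f\<close>. Otherwise \<open>b \<le> 2 * \<epsilon>\<close> and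
  \<open>D \<le> m * w\<close> by Bernoulli's inequality, so that
  \<open>D * b \<le> \<sigma> * w \<le> f\<close>.\<close>

lemma unanimity_bound:
  fixes w b f \<sigma> \<epsilon> :: real
  assumes w: "0 \<le> w" "w \<le> 1" and b: "0 \<le> b" "b \<le> f + \<epsilon>"
    and wf: "\<sigma> * w \<le> f" "w ^ m \<le> 2 * f" and \<epsilon>: "2 * \<epsilon> * real m \<le> \<sigma>"
  shows "w ^ m + (1 - w ^ m - (1 - w) ^ m) * b \<le> 4 * f"
proof -
  define D where "D = 1 - w ^ m - (1 - w) ^ m"
  have pw: "0 \<le> w ^ m" "0 \<le> (1 - w) ^ m" using w by auto
  have "D \<le> 1" using pw by (simp add: D_def)
  have "1 + real m * (- w) \<le> (1 + (- w)) ^ m" using w by (intro Bernoulli_inequality) auto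
  then have D: "D \<le> real m * w" using pw by (simp add: D_def)
  show ?thesis
  proof (cases "f \<ge> \<epsilon>")
    case True
    have "D * b \<le> 1 * b" using \<open>D \<le> 1\<close> b by (intro mult_right_mono)
    then show ?thesis using True b wf(2) unfolding D_def[symmetric] by linarith
  next
    case False
    have "D * b \<le> (real m * w) * b" using D b by (intro mult_right_mono)
    also have "\<dots> \<le> (real m * w) * (2 * \<epsilon>)" using False b w by (intro mult_left_mono) auto
    also have "\<dots> = (2 * \<epsilon> * real m) * w" by simp
    also have "\<dots> \<le> \<sigma> * w" using \<epsilon> w by (intro mult_right_mono)
    finally show ?thesis using wf pw unfolding D_def[symmetric] by linarith
  qed
qed

lemma ex_implementable_comparable:
  fixes f :: "real^'n::finite \<Rightarrow> real"
  assumes f: "\<And>p. p \<in> unit_cube \<Longrightarrow> 0 \<le> f p \<and> f p \<le> 1" "continuous_on unit_cube f"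
    and pb: "poly_bounded f" "poly_bounded (\<lambda>p. 1 - f p)"
  obtains g where "bernoulli_implementable g"
    "\<And>p. p \<in> unit_cube \<Longrightarrow> g p \<le> 4 * f p" "\<And>p. p \<in> unit_cube \<Longrightarrow> 1 - g p \<le> 4 * (1 - f p)"
proof -
  obtain w \<sigma> where w: "bernoulli_implementable w" and \<sigma>: "\<sigma> > 0"
    "\<And>p. p \<in> unit_cube \<Longrightarrow> \<sigma> * w p \<le> f p" "\<And>p. p \<in> unit_cube \<Longrightarrow> \<sigma> * (1 - w p) \<le> 1 - f p"
    and w01: "\<And>p. p \<in> unit_cube \<Longrightarrow> 0 < f p \<Longrightarrow> 0 < w p" "\<And>p. p \<in> unit_cube \<Longrightarrow> f p < 1 \<Longrightarrow> w p < 1"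
    using ex_implementable_separator[OF f(1) pb] by metis
  note wbd = implementable_bounds[OF w]
  have cw: "continuous_on unit_cube w" by (rule implementable_imp_continuous[OF w])
  \<comment> \<open>Where \<open>f p \<le> 1 / 2\<close> the maximum is 0, so a lower bound keeps
    \<open>w p\<close> away from 1. Positivity comes from \<open>w p < 1\<close> if
    \<open>f p < 1\<close> and from the maximum if \<open>f p = 1\<close>.\<close>
  have "continuous_on unit_cube (\<lambda>p. (1 - w p) + max 0 (f p - 1 / 2))"
    by (intro continuous_intros cw f(2))
  moreover have "0 < (1 - w p) + max 0 (f p - 1 / 2)" if "p \<in> unit_cube" for p
    using w01(2)[OF that] f(1)[OF that] wbd(2)[OF that] by (cases "f p < 1") (auto simp: max_def)
  ultimately obtain \<tau>1 where \<tau>1: "\<tau>1 > 0" "\<And>p. p \<in> unit_cube \<Longrightarrow> \<tau>1 \<le> (1 - w p) + max 0 (f p - 1 / 2)"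
    using cube_positive_lower_bound by blast
  \<comment> \<open>The mirror image keeps \<open>w p\<close> away from 0 where
    \<open>f p \<ge> 1 / 2\<close>.\<close>
  have "continuous_on unit_cube (\<lambda>p. w p + max 0 (1 / 2 - f p))"
    by (intro continuous_intros cw f(2))
  moreover have "0 < w p + max 0 (1 / 2 - f p)" if "p \<in> unit_cube" for p
    using w01(1)[OF that] f(1)[OF that] wbd(1)[OF that] by (cases "0 < f p") (auto simp: max_def)
  ultimately obtain \<tau>2 where \<tau>2: "\<tau>2 > 0" "\<And>p. p \<in> unit_cube \<Longrightarrow> \<tau>2 \<le> w p + max 0 (1 / 2 - f p)"
    using cube_positive_lower_bound by blast
  define \<tau> where "\<tau> = min \<tau>1 \<tau>2"
  have \<tau>: "\<tau> > 0" "\<tau> \<le> \<tau>1" "\<tau> \<le> \<tau>2" using \<tau>1 \<tau>2 by (auto simp: \<tau>_def)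
  \<comment> \<open>With this \<open>j\<close>, one further factor \<open>x\<close> turns
    \<open>x ^ j \<le> \<sigma>\<close> into a bound by \<open>\<sigma> * x\<close>, which the
    separator compares with \<open>f\<close> or \<open>1 - f\<close>.\<close>
  obtain j where j: "(1 - \<tau>) ^ j < \<sigma>"
    using real_arch_pow_inv[OF \<sigma>(1), of "1 - \<tau>"] \<tau> by auto
  have pow: "x ^ Suc j \<le> \<sigma> * x" if "0 \<le> x" "x \<le> 1 - \<tau>" for x
  proof -
    have "x ^ j \<le> (1 - \<tau>) ^ j" using that by (intro power_mono) auto
    then have "x * x ^ j \<le> x * \<sigma>" using j that by (intro mult_left_mono) auto
    then show ?thesis by (simp add: mult.commute)
  qed
  have wm: "w p ^ Suc j \<le> 2 * f p" "(1 - w p) ^ Suc j \<le> 2 * (1 - f p)" if p: "p \<in> unit_cube" for p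
  proof -
    show "w p ^ Suc j \<le> 2 * f p"
    proof (cases "f p \<le> 1 / 2")
      case True
      then have "w p ^ Suc j \<le> \<sigma> * w p" using \<tau> \<tau>1(2)[OF p] wbd[OF p] by (intro pow) auto
      then show ?thesis using \<sigma>(2)[OF p] f(1)[OF p] by linarith
    next
      case False
      then show ?thesis using power_le_one[of "w p" "Suc j"] wbd[OF p] by linarith
    qed
    show "(1 - w p) ^ Suc j \<le> 2 * (1 - f p)"
    proof (cases "f p \<ge> 1 / 2")
      case True
      then have "(1 - w p) ^ Suc j \<le> \<sigma> * (1 - w p)" using \<tau> \<tau>2(2)[OF p] wbd[OF p] by (intro pow) auto
      also note \<sigma>(3)[OF p]
      also have "1 - f p \<le> 2 * (1 - f p)" using f(1)[OF p] by simp
      finally show ?thesis .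
    next
      case False
      have "(1 - w p) ^ Suc j \<le> 1" using wbd[OF p] by (intro power_le_one) auto
      also have "1 \<le> 2 * (1 - f p)" using False by simp
      finally show ?thesis .
    qed
  qed
  \<comment> \<open>Makes the last hypothesis of \<open>unanimity_bound\<close> an equality for
    \<open>Suc j\<close> flips.\<close>
  define \<epsilon> where "\<epsilon> = \<sigma> / (2 * real (Suc j))"
  have \<epsilon>: "\<epsilon> > 0" "2 * \<epsilon> * real (Suc j) \<le> \<sigma>" using \<sigma>(1) by (simp_all add: \<epsilon>_def del: of_nat_Suc)
  obtain b where b: "bernoulli_implementable b" "\<And>p. p \<in> unit_cube \<Longrightarrow> \<bar>b p - f p\<bar> \<le> \<epsilon>"
    using implementable_approx[OF f(2,1) \<epsilon>(1)] by blast
  \<comment> \<open>The unanimity experiment with the first of \<open>Suc j\<close> flips split off,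
    which exhibits it as nested mixtures.\<close>
  define g where "g p = w p * (w p ^ j * 1 + (1 - w p ^ j) * b p)
    + (1 - w p) * ((1 - w p) ^ j * 0 + (1 - (1 - w p) ^ j) * b p)" for p
  have g: "g p = w p ^ Suc j + (1 - w p ^ Suc j - (1 - w p) ^ Suc j) * b p" for p
    by (simp add: g_def algebra_simps)
  show ?thesis
  proof
    show "bernoulli_implementable g"
      unfolding g_def[abs_def]
      by (intro implementable_mix implementable_power implementable_compl w b implementable_const) auto
    fix p :: "real^'n" assume p: "p \<in> unit_cube"
    note bd = wbd[OF p] implementable_bounds[OF b(1) p] b(2)[OF p]
    show "g p \<le> 4 * f p"
      unfolding g using bd \<sigma>(2)[OF p] wm[OF p] \<epsilon>(2) by (intro unanimity_bound[where \<sigma> = \<sigma> and \<epsilon> = \<epsilon>]) auto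
    \<comment> \<open>The experiment is symmetric under complementing \<open>w\<close>,
      \<open>b\<close> and \<open>f\<close>.\<close>
    have "1 - g p = (1 - w p) ^ Suc j + (1 - (1 - w p) ^ Suc j - (1 - (1 - w p)) ^ Suc j) * (1 - b p)"
      unfolding g by (simp add: algebra_simps)
    also have "\<dots> \<le> 4 * (1 - f p)"
      using bd \<sigma>(3)[OF p] wm[OF p] \<epsilon>(2) by (intro unanimity_bound[where \<sigma> = \<sigma> and \<epsilon> = \<epsilon>]) auto
    finally show "1 - g p \<le> 4 * (1 - f p)" .
  qed
qed

section \<open>Iterated decomposition\<close>

definition admissible :: "(real^'n::finite \<Rightarrow> real) \<Rightarrow> bool" where
  "admissible f \<longleftrightarrow> (\<forall>p\<in>unit_cube. 0 \<le> f p \<and> f p \<le> 1) \<and> continuous_on unit_cube f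
     \<and> poly_bounded f \<and> poly_bounded (\<lambda>p. 1 - f p)"

text \<open>The remainder \<open>h\<close> solves \<open>f = g / 8 + 7 / 8 * h\<close>. Since
  \<open>8 * f - g \<ge> 4 * f\<close>, half of \<open>f\<close> survives, and likewise for
  \<open>1 - f\<close>; this yields both the range and the polynomial bounds of
  \<open>h\<close>.\<close>

lemma admissible_remainder:
  fixes f :: "real^'n::finite \<Rightarrow> real"
  assumes f: "admissible f"
  shows "\<exists>g. bernoulli_implementable g \<and> admissible (\<lambda>p. (8 * f p - g p) / 7)"
proof -
  note f' = f[unfolded admissible_def]
  obtain g where g: "bernoulli_implementable g" "\<And>p. p \<in> unit_cube \<Longrightarrow> g p \<le> 4 * f p"
    "\<And>p. p \<in> unit_cube \<Longrightarrow> 1 - g p \<le> 4 * (1 - f p)"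
    using ex_implementable_comparable[of f] f' by blast
  let ?h = "\<lambda>p. (8 * f p - g p) / 7"
  have ge: "4 / 7 * f p \<le> ?h p" "4 / 7 * (1 - f p) \<le> 1 - ?h p" if "p \<in> unit_cube" for p
    using g(2,3)[OF that] by (simp_all add: field_simps)
  have "0 \<le> ?h p \<and> ?h p \<le> 1" if "p \<in> unit_cube" for p
    using ge[OF that] f'[THEN conjunct1, rule_format, OF that] by argo
  moreover have "continuous_on unit_cube ?h"
    using f' implementable_imp_continuous[OF g(1)] by (auto intro!: continuous_intros)
  moreover have "poly_bounded ?h"
  proof (rule poly_bounded_transfer[where f = f and d = "4 / 7"])
    show "?h p = 0" if "p \<in> unit_cube" "f p = 0" for p
      using g(2)[OF that(1)] implementable_bounds[OF g(1) that(1)] that(2) by simp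
  qed (use f' ge in auto)
  moreover have "poly_bounded (\<lambda>p. 1 - ?h p)"
  proof (rule poly_bounded_transfer[where f = "\<lambda>p. 1 - f p" and d = "4 / 7"])
    show "1 - ?h p = 0" if "p \<in> unit_cube" "1 - f p = 0" for p
      using g(3)[OF that(1)] implementable_bounds[OF g(1) that(1)] that(2) by simp
  qed (use f' ge in auto)
  ultimately show ?thesis using g(1) unfolding admissible_def by (intro exI[of _ g]) simp
qed

lemma admissible_imp_implementable:
  fixes f :: "real^'n::finite \<Rightarrow> real"
  assumes "admissible f"
  shows "bernoulli_implementable f"
proof -
  obtain G where G: "\<And>f :: real^'n \<Rightarrow> real. admissible f \<Longrightarrow>
      bernoulli_implementable (G f) \<and> admissible (\<lambda>p. (8 * f p - G f p) / 7)"
    using admissible_remainder by metis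
  \<comment> \<open>\<open>F k\<close> is the function still to be realised once \<open>k\<close>
    rounds have failed.\<close>
  define F where "F = rec_nat f (\<lambda>_ f p. (8 * f p - G f p) / 7)"
  have F: "F 0 = f" "F (Suc k) = (\<lambda>p. (8 * F k p - G (F k) p) / 7)" for k
    by (simp_all add: F_def)
  have adm: "admissible (F k)" for k
    by (induction k) (use assms G F in auto)
  have "bernoulli_implementable (F 0)"
  proof (rule implementable_sequential[where r = F and a = "\<lambda>_ _. 1 / 8" and b = "\<lambda>k. G (F k)"])
    \<comment> \<open>Each round stops with probability 1/8, independently of
      \<open>p\<close>.\<close>
    show "(\<lambda>K. \<Prod>j<K. 1 - 1 / 8 :: real) \<longlonglongrightarrow> 0"
      by (simp add: LIMSEQ_power_zero)
    show "F k p = 1 / 8 * G (F k) p + (1 - 1 / 8) * F (Suc k) p" for k p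
      by (simp add: F field_simps)
  qed (use adm G in \<open>auto simp: admissible_def implementable_const\<close>)
  then show ?thesis by (simp add: F)
qed

theorem theorem1:
  fixes f :: "real^'n::finite \<Rightarrow> real"
  assumes "\<forall>p\<in>unit_cube. 0 \<le> f p \<and> f p \<le> 1"
  shows "bernoulli_implementable f \<longleftrightarrow>
           continuous_on unit_cube f \<and> poly_bounded f \<and> poly_bounded (\<lambda>p. 1 - f p)"
proof
  assume "bernoulli_implementable f"
  then show "continuous_on unit_cube f \<and> poly_bounded f \<and> poly_bounded (\<lambda>p. 1 - f p)"
    using implementable_imp_continuous implementable_imp_poly_bounded implementable_compl by blast
next
  assume "continuous_on unit_cube f \<and> poly_bounded f \<and> poly_bounded (\<lambda>p. 1 - f p)"
  then show "bernoulli_implementable f"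
    using assms by (intro admissible_imp_implementable) (simp add: admissible_def)
qed

end
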